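(* Let $k\in\mathbb N$. The poset $(\mathfrak L_{\mathrm{qpp}}(R^k_{\{0,1\}}),\subseteq)$ of all $k$-sorted quantified relational clones on $\{0,1\}$ embeds into the product poset $(2^{CR^k_{1-6}},\subseteq)\times(\mathfrak L_{\downarrow}(\mathbb N_0^{2k}),\subseteq)$, where $\mathfrak L_{\downarrow}(\mathbb N_0^{2k})$ is the set of downsets of $\mathbb N_0^{2k}$ with respect to the product (componentwise) ordering.
   Context: $E_k=\{1,\dots,k\}$, $\mathbb N_0=\{0,1,2,\dots\}$. $R^k_{\{0,1\}}$ is the set of $k$-sorted relations on $\{0,1\}$: subsets of $\{0,1\}^n$ with each variable assigned a sort in $E_k$. $\sigma_\bot$ is the empty $0$-ary relation and $\sigma^i_=$ equality on sort $i$. $\langle S\rangle_{\mathrm{qpp}}$ is the set of relations definable by formulas built from predicates in $S\cup\{\sigma_\bot,\sigma_=^1,\dots,\sigma_=^k\}$ using conjunction, existential and universal quantification only, each variable having one sort and substituted only into positions of that sort. A quantified relational clone is a set $S\subseteq R^k_{\{0,1\}}$ with $\langle S\rangle_{\mathrm{qpp}}=S$; $\mathfrak L_{\mathrm{qpp}}(R^k_{\{0,1\}})$ is the set of these. A variable is dummy if the predicate does not depend on it. A $k$-sorted relation without dummy variables is canonical if, up to order of variables, it equals one of (superscripts are sorts, arithmetic mod 2, $i,j,s_t\in E_k$, $b,b_t\in\{0,1\}$): (c1) $x^i=0\lor y^i=1$; (c2) $x^i=y^i\lor u^j=b$; (c3) $x^i=y^i\lor u^j=v^j$ with $i\ne j$,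 or $x^i=y^i\lor y^i=z^i$; (c4) $x^i+y^i=1$; (c5) $x^i+y^i=u^j+v^j$; (c6) $x^{s_1}+\dots+x^{s_n}=b$ with $n\ge2$, $s_t$ pairwise distinct; (c7) $\bigvee_{t=1}^{n}\bigvee_{p=1}^{m_t}(x_p^{s_t}=b_t)$ with $s_t$ pairwise distinct. $CR^k_{1-6}$ is the (finite) set of $k$-sorted canonical relations of types (c1)–(c6), and $2^{CR^k_{1-6}}$ its power set. A downset of a poset $(P,\le)$ is $D\subseteq P$ with $q\in D,\ p\le q\Rightarrow p\in D$. A poset $(Q,\preceq)$ embeds into $(P,\le)$ if there is an injective map $\nu:Q\to P$ with $p\preceq q\Rightarrow\nu(p)\le\nu(q)$. The product of posets is ordered componentwise. *)

theory Defs
  imports "HOL-Library.Z2" "HOL-Library.FuncSet" "HOL-Combinatorics.Permutations"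
begin

section \<open>Multi-sorted relations on \<open>{0, 1}\<close>\<close>

text \<open>The domain \<open>{0, 1}\<close> is the two-element field \<^typ>\<open>bit\<close>, whose addition is addition
  modulo 2.  A relation is a pair \<open>(s, A)\<close>: its arity is \<^term>\<open>length s\<close>, \<open>s ! p\<close> is the sort
  of its \<open>p\<close>-th variable, and \<open>A\<close> is the set of its tuples.  In particular, empty relations with
  different sort lists are different.\<close>

type_synonym srel = "nat list \<times> bit list set"

definition sorted_rels :: "nat \<Rightarrow> srel set" where
  "sorted_rels k = {(s, A). set s \<subseteq> {1..k} \<and> A \<subseteq> {a. length a = length s}}"

definition sigma_bot :: srel where
  "sigma_bot = ([], {})"

definition sigma_eq :: "nat \<Rightarrow> srel" where
  "sigma_eq i = ([i, i], {[x, y] | x y. x = y})"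


section \<open>Quantified positive primitive definability\<close>

text \<open>A variable is a pair of its sort and a name, so every variable has exactly one sort.\<close>

type_synonym svar = "nat \<times> nat"

datatype qfm =
    Pred srel "svar list"
  | Conj qfm qfm
  | Ex svar qfm
  | All svar qfm

text \<open>\<open>qfm_over k P \<phi>\<close>: all predicates of \<open>\<phi>\<close> are in \<open>P\<close>, variables are substituted only into
  positions of their own sort, and quantified variables have a sort in \<open>{1..k}\<close>.\<close>

primrec qfm_over :: "nat \<Rightarrow> srel set \<Rightarrow> qfm \<Rightarrow> bool" where
  "qfm_over k P (Pred R xs) \<longleftrightarrow> R \<in> P \<and> map fst xs = fst R"
| "qfm_over k P (Conj \<phi> \<psi>) \<longleftrightarrow> qfm_over k P \<phi> \<and> qfm_over k P \<psi>"
| "qfm_over k P (Ex x \<phi>) \<longleftrightarrow> fst x \<in> {1..k} \<and> qfm_over k P \<phi>"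
| "qfm_over k P (All x \<phi>) \<longleftrightarrow> fst x \<in> {1..k} \<and> qfm_over k P \<phi>"

primrec free_vars :: "qfm \<Rightarrow> svar set" where
  "free_vars (Pred R xs) = set xs"
| "free_vars (Conj \<phi> \<psi>) = free_vars \<phi> \<union> free_vars \<psi>"
| "free_vars (Ex x \<phi>) = free_vars \<phi> - {x}"
| "free_vars (All x \<phi>) = free_vars \<phi> - {x}"

primrec sat :: "(svar \<Rightarrow> bit) \<Rightarrow> qfm \<Rightarrow> bool" where
  "sat v (Pred R xs) \<longleftrightarrow> map v xs \<in> snd R"
| "sat v (Conj \<phi> \<psi>) \<longleftrightarrow> sat v \<phi> \<and> sat v \<psi>"
| "sat v (Ex x \<phi>) \<longleftrightarrow> (\<exists>a. sat (v(x := a)) \<phi>)"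
| "sat v (All x \<phi>) \<longleftrightarrow> (\<forall>a. sat (v(x := a)) \<phi>)"

text \<open>The relation defined by \<open>\<phi>(x\<^sub>1, \<dots>, x\<^sub>n)\<close>, where \<open>xs = [x\<^sub>1, \<dots>, x\<^sub>n]\<close>.\<close>

definition defined_rel :: "svar list \<Rightarrow> qfm \<Rightarrow> srel" where
  "defined_rel xs \<phi> = (map fst xs, {map v xs | v. sat v \<phi>})"

definition qpp_closure :: "nat \<Rightarrow> srel set \<Rightarrow> srel set" where
  "qpp_closure k S = {defined_rel xs \<phi> | xs \<phi>.
     distinct xs \<and> fst ` set xs \<subseteq> {1..k} \<and> free_vars \<phi> \<subseteq> set xs \<and>
     qfm_over k (S \<union> {sigma_bot} \<union> sigma_eq ` {1..k}) \<phi>}"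

definition quantified_relational_clones :: "nat \<Rightarrow> srel set set" where
  "quantified_relational_clones k = {S. S \<subseteq> sorted_rels k \<and> qpp_closure k S = S}"


section \<open>Canonical relations\<close>

definition dummy :: "srel \<Rightarrow> nat \<Rightarrow> bool" where
  "dummy R p \<longleftrightarrow> p < length (fst R) \<and>
     (\<forall>a c. length a = length (fst R) \<longrightarrow> (a[p := c] \<in> snd R \<longleftrightarrow> a \<in> snd R))"

definition eq_up_to_order :: "srel \<Rightarrow> srel \<Rightarrow> bool" where
  "eq_up_to_order R R' \<longleftrightarrow> (\<exists>\<pi>. \<pi> permutes {..<length (fst R)} \<and>
     R' = (permute_list \<pi> (fst R), permute_list \<pi> ` snd R))"

text \<open>The six types of canonical relations other than disjunctions of literals.  Different letters denote different variables,
  whereas the sorts \<open>i\<close> and \<open>j\<close> may coincide unless stated otherwise.\<close>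

inductive_set canonical_shapes :: "nat \<Rightarrow> srel set" for k :: nat where
  c1: "i \<in> {1..k} \<Longrightarrow> ([i, i], {[x, y] | x y. x = 0 \<or> y = 1}) \<in> canonical_shapes k"
| c2: "i \<in> {1..k} \<Longrightarrow> j \<in> {1..k} \<Longrightarrow>
    ([i, i, j], {[x, y, u] | x y u. x = y \<or> u = b}) \<in> canonical_shapes k"
| c3_diff: "i \<in> {1..k} \<Longrightarrow> j \<in> {1..k} \<Longrightarrow> i \<noteq> j \<Longrightarrow>
    ([i, i, j, j], {[x, y, u, v] | x y u v. x = y \<or> u = v}) \<in> canonical_shapes k"
| c3_same: "i \<in> {1..k} \<Longrightarrow>
    ([i, i, i], {[x, y, z] | x y z. x = y \<or> y = z}) \<in> canonical_shapes k"
| c4: "i \<in> {1..k} \<Longrightarrow> ([i, i], {[x, y] | x y. x + y = 1}) \<in> canonical_shapes k"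
| c5: "i \<in> {1..k} \<Longrightarrow> j \<in> {1..k} \<Longrightarrow>
    ([i, i, j, j], {[x, y, u, v] | x y u v. x + y = u + v}) \<in> canonical_shapes k"
| c6: "set s \<subseteq> {1..k} \<Longrightarrow> distinct s \<Longrightarrow> length s \<ge> 2 \<Longrightarrow>
    (s, {a. length a = length s \<and> sum_list a = b}) \<in> canonical_shapes k"

definition CR_1_6 :: "nat \<Rightarrow> srel set" where
  "CR_1_6 k = {R \<in> sorted_rels k. (\<forall>p. \<not> dummy R p) \<and>
     (\<exists>R0 \<in> canonical_shapes k. eq_up_to_order R0 R)}"


section \<open>Posets\<close>

definition downsets :: "'a set \<Rightarrow> ('a \<Rightarrow> 'a \<Rightarrow> bool) \<Rightarrow> 'a set set" where
  "downsets P le = {D. D \<subseteq> P \<and> (\<forall>q\<in>D. \<forall>p\<in>P. le p q \<longrightarrow> p \<in> D)}"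

text \<open>Following the source, an embedding is an injective order-preserving map; it is not required
  to reflect the order.\<close>

definition poset_embeds ::
  "'a set \<Rightarrow> ('a \<Rightarrow> 'a \<Rightarrow> bool) \<Rightarrow> 'b set \<Rightarrow> ('b \<Rightarrow> 'b \<Rightarrow> bool) \<Rightarrow> bool" where
  "poset_embeds Q leQ P leP \<longleftrightarrow>
     (\<exists>\<nu>. \<nu> ` Q \<subseteq> P \<and> inj_on \<nu> Q \<and> monotone_on Q leQ leP \<nu>)"

definition nat_vecs :: "nat \<Rightarrow> (nat \<Rightarrow> nat) set" where
  "nat_vecs n = {..<n} \<rightarrow>\<^sub>E UNIV"

definition vec_le :: "nat \<Rightarrow> (nat \<Rightarrow> nat) \<Rightarrow> (nat \<Rightarrow> nat) \<Rightarrow> bool" where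
  "vec_le n p q \<longleftrightarrow> (\<forall>i<n. p i \<le> q i)"

end

theory Submission
  imports Defs
begin

text \<open>To a clone \<open>S\<close> assign its canonical relations together with the vectors counting, for each sort
  and each bit, the literals of the disjunctions of literals definable in \<open>S\<close>; these vectors form a
  downset because universal quantification deletes a literal.  For injectivity, let \<open>P\<close> be maximal
  among the predicates definable in \<open>S\<close> that fail at a given point.  The set where \<open>P\<close> fails turns
  out to be an affine space over the two-element field, so that \<open>P\<close> is a disjunction
  \<open>\<Or>\<^sub>t x\<^sub>t + \<ell>\<^sub>t(y) = e\<^sub>t\<close> of linear equations.  Universal quantification gives each single equation,
  and eliminating \<open>y\<close> by means of these gives the relations \<open>x\<^sub>t = x'\<^sub>t \<or> x\<^sub>s = x'\<^sub>s\<close> (or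
  \<open>x\<^sub>t = x'\<^sub>t \<or> x\<^sub>s = b\<close> if \<open>\<ell>\<^sub>s\<close> vanishes), from which the whole disjunction is recovered by composition
  along a chain of existentially quantified variables.\<close>

section \<open>Definable predicates\<close>

text \<open>Sums and products of bits stay in ring notation, so that the lemmas on finite sums
  apply.\<close>

declare add_bit_eq_xor [simp del] mult_bit_eq_and [simp del]

lemma bit_add_self [simp]: "(a::bit) + a = 0"
  by (cases a) auto

text \<open>Definability is a property of predicates on all valuations, not of relations with a list
  of variables, so that closure under logical operations can be stated without aligning variable
  lists.\<close>

definition definable :: "nat \<Rightarrow> srel set \<Rightarrow> ((svar \<Rightarrow> bit) \<Rightarrow> bool) set" where
  "definable k S = {P. \<exists>\<phi>. qfm_over k (S \<union> {sigma_bot} \<union> sigma_eq ` {1..k}) \<phi> \<and> P = (\<lambda>v. sat v \<phi>)}"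

definition depends_on :: "svar set \<Rightarrow> ((svar \<Rightarrow> bit) \<Rightarrow> bool) \<Rightarrow> bool" where
  "depends_on X P \<longleftrightarrow> (\<forall>v w. (\<forall>x\<in>X. v x = w x) \<longrightarrow> P v = P w)"

lemma depends_onD: "depends_on X P \<Longrightarrow> (\<And>x. x \<in> X \<Longrightarrow> v x = w x) \<Longrightarrow> P v = P w"
  unfolding depends_on_def by blast

lemma ex_bit: "(\<exists>a::bit. P a) \<longleftrightarrow> P 0 \<or> P 1"
  by (metis bit.exhaust)

text \<open>A predicate depending only on a finite \<open>X\<close> is determined by its values on
  these valuations, so maximal predicates exist and conjunctions over its points are finite.\<close>

lemma finite_valuations:
  assumes "finite X"
  shows "finite {v :: 'a \<Rightarrow> bit. \<forall>x. x \<notin> X \<longrightarrow> v x = 0}"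
proof -
  have "finite {v. \<forall>x. (x \<in> X \<longrightarrow> v x \<in> {0::bit, 1}) \<and> (x \<notin> X \<longrightarrow> v x = 0)}"
    using assms by (intro finite_set_of_finite_funs) auto
  moreover have "v x \<in> {0::bit, 1}" for v and x :: 'a
    by (metis bit.exhaust insertCI)
  ultimately show ?thesis by simp
qed

lemma fresh_var:
  assumes "finite X"
  obtains z :: svar where "fst z = i" "z \<notin> X"
proof -
  have "infinite ({i} \<times> (UNIV :: nat set))"
    by (simp add: finite_cartesian_product_iff)
  then obtain z where "z \<in> {i} \<times> UNIV" "z \<notin> X"
    using assms by (metis finite_subset subsetI)
  then show ?thesis using that by auto
qed

lemma sat_cong: "(\<And>x. x \<in> free_vars \<phi> \<Longrightarrow> v x = w x) \<Longrightarrow> sat v \<phi> = sat w \<phi>"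
proof (induction \<phi> arbitrary: v w)
  case (Pred R xs)
  then have "map v xs = map w xs" by simp
  then show ?case by (simp only: sat.simps)
next
  case (Conj \<phi> \<psi>)
  have "sat v \<phi> = sat w \<phi>" by (rule Conj.IH) (simp add: Conj.prems)
  moreover have "sat v \<psi> = sat w \<psi>" by (rule Conj.IH) (simp add: Conj.prems)
  ultimately show ?case by simp
next
  case (Ex x \<phi>)
  have "sat (v(x := a)) \<phi> = sat (w(x := a)) \<phi>" for a
    by (rule Ex.IH) (simp add: Ex.prems)
  then show ?case by simp
next
  case (All x \<phi>)
  have "sat (v(x := a)) \<phi> = sat (w(x := a)) \<phi>" for a
    by (rule All.IH) (simp add: All.prems)
  then show ?case by simp
qed

lemma finite_free_vars: "finite (free_vars \<phi>)"
  by (induction \<phi>) auto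

lemma free_vars_sorts:
  "qfm_over k (S \<union> {sigma_bot} \<union> sigma_eq ` {1..k}) \<phi> \<Longrightarrow> S \<subseteq> sorted_rels k \<Longrightarrow>
    fst ` free_vars \<phi> \<subseteq> {1..k}"
proof (induction \<phi>)
  case (Pred R xs)
  then have "fst ` set xs = set (fst R)" by (metis image_set qfm_over.simps(1))
  moreover have "R \<in> sorted_rels k"
    using Pred by (auto simp: sorted_rels_def sigma_bot_def sigma_eq_def)
  then have "set (fst R) \<subseteq> {1..k}" by (auto simp: sorted_rels_def)
  ultimately show ?case by simp
qed (auto simp: image_subset_iff)

text \<open>Tracks the free variables, because \<open>qpp_closure\<close> admits only formulas whose
  free variables lie among the listed ones.\<close>

lemma exists_closure:
  assumes "finite Y" "fst ` Y \<subseteq> {1..k}" "qfm_over k B \<phi>"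
  shows "\<exists>\<psi>. qfm_over k B \<psi> \<and> free_vars \<psi> = free_vars \<phi> - Y \<and>
    (\<forall>v. sat v \<psi> \<longleftrightarrow> (\<exists>w. sat (override_on v w Y) \<phi>))"
  using assms
proof (induction Y rule: finite_induct)
  case empty
  then show ?case by auto
next
  case (insert y Y)
  then obtain \<psi> where \<psi>: "qfm_over k B \<psi>" "free_vars \<psi> = free_vars \<phi> - Y"
    "\<And>v. sat v \<psi> \<longleftrightarrow> (\<exists>w. sat (override_on v w Y) \<phi>)" by auto
  have "(\<exists>a w. sat (override_on (v(y := a)) w Y) \<phi>) \<longleftrightarrow> (\<exists>w. sat (override_on v w (insert y Y)) \<phi>)" for v
  proof
    assume "\<exists>a w. sat (override_on (v(y := a)) w Y) \<phi>"
    then obtain a w where "sat (override_on (v(y := a)) w Y) \<phi>" by blast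
    also have "override_on (v(y := a)) w Y = override_on v (w(y := a)) (insert y Y)"
      using insert.hyps by (auto simp: override_on_def)
    finally show "\<exists>w. sat (override_on v w (insert y Y)) \<phi>" by blast
  next
    assume "\<exists>w. sat (override_on v w (insert y Y)) \<phi>"
    then obtain w where "sat (override_on v w (insert y Y)) \<phi>" by blast
    also have "override_on v w (insert y Y) = override_on (v(y := w y)) w Y"
      using insert.hyps by (auto simp: override_on_def)
    finally show "\<exists>a w. sat (override_on (v(y := a)) w Y) \<phi>" by blast
  qed
  then show ?case
    using \<psi> insert.prems by (intro exI[of _ "Ex y \<psi>"]) auto
qed

lemma definable_mono: "S \<subseteq> T \<Longrightarrow> definable k S \<subseteq> definable k T"
proof -
  assume "S \<subseteq> T"
  then have "qfm_over k (S \<union> {sigma_bot} \<union> sigma_eq ` {1..k}) \<phi> \<Longrightarrow>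
    qfm_over k (T \<union> {sigma_bot} \<union> sigma_eq ` {1..k}) \<phi>" for \<phi>
    by (induction \<phi>) auto
  then show ?thesis unfolding definable_def by blast
qed

section \<open>Closure properties of the predicates definable in a clone\<close>

locale clone =
  fixes k :: nat and S :: "srel set"
  assumes k_pos: "k \<ge> 1" and clone: "S \<in> quantified_relational_clones k"
begin

abbreviation D where "D \<equiv> definable k S"

lemma sorted: "S \<subseteq> sorted_rels k"
  using clone by (simp add: quantified_relational_clones_def)

lemma support:
  assumes "P \<in> D"
  obtains X where "finite X" "fst ` X \<subseteq> {1..k}" "depends_on X P"
proof -
  obtain \<phi> where \<phi>: "qfm_over k (S \<union> {sigma_bot} \<union> sigma_eq ` {1..k}) \<phi>" "P = (\<lambda>v. sat v \<phi>)"
    using assms by (auto simp: definable_def)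
  have "depends_on (free_vars \<phi>) P"
    unfolding depends_on_def \<phi>(2) by (intro allI impI, rule sat_cong) blast
  then show ?thesis
    using that finite_free_vars free_vars_sorts[OF \<phi>(1) sorted] by blast
qed

lemma conj_D: "P \<in> D \<Longrightarrow> Q \<in> D \<Longrightarrow> (\<lambda>v. P v \<and> Q v) \<in> D"
  unfolding definable_def
proof clarsimp
  fix \<phi> \<psi>
  assume "qfm_over k (insert sigma_bot (S \<union> sigma_eq ` {Suc 0..k})) \<phi>"
    "qfm_over k (insert sigma_bot (S \<union> sigma_eq ` {Suc 0..k})) \<psi>"
  then show "\<exists>\<chi>. qfm_over k (insert sigma_bot (S \<union> sigma_eq ` {Suc 0..k})) \<chi> \<and>
    (\<lambda>v. sat v \<phi> \<and> sat v \<psi>) = (\<lambda>v. sat v \<chi>)"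
    by (intro exI[of _ "Conj \<phi> \<psi>"]) simp
qed

lemma ex_D: "P \<in> D \<Longrightarrow> fst x \<in> {1..k} \<Longrightarrow> (\<lambda>v. \<exists>a. P (v(x := a))) \<in> D"
  unfolding definable_def
proof clarsimp
  fix \<phi>
  assume "qfm_over k (insert sigma_bot (S \<union> sigma_eq ` {Suc 0..k})) \<phi>" "Suc 0 \<le> fst x" "fst x \<le> k"
  then show "\<exists>\<chi>. qfm_over k (insert sigma_bot (S \<union> sigma_eq ` {Suc 0..k})) \<chi> \<and>
    (\<lambda>v. \<exists>a. sat (v(x := a)) \<phi>) = (\<lambda>v. sat v \<chi>)"
    by (intro exI[of _ "Ex x \<phi>"]) simp
qed

lemma all_D: "P \<in> D \<Longrightarrow> fst x \<in> {1..k} \<Longrightarrow> (\<lambda>v. \<forall>a. P (v(x := a))) \<in> D"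
  unfolding definable_def
proof clarsimp
  fix \<phi>
  assume "qfm_over k (insert sigma_bot (S \<union> sigma_eq ` {Suc 0..k})) \<phi>" "Suc 0 \<le> fst x" "fst x \<le> k"
  then show "\<exists>\<chi>. qfm_over k (insert sigma_bot (S \<union> sigma_eq ` {Suc 0..k})) \<chi> \<and>
    (\<lambda>v. \<forall>a. sat (v(x := a)) \<phi>) = (\<lambda>v. sat v \<chi>)"
    by (intro exI[of _ "All x \<phi>"]) simp
qed

lemma ex_set_D:
  assumes "P \<in> D" "finite Y" "fst ` Y \<subseteq> {1..k}"
  shows "(\<lambda>v. \<exists>w. P (override_on v w Y)) \<in> D"
proof -
  obtain \<phi> where "qfm_over k (S \<union> {sigma_bot} \<union> sigma_eq ` {1..k}) \<phi>" "P = (\<lambda>v. sat v \<phi>)"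
    using assms by (auto simp: definable_def)
  with exists_closure[OF assms(2,3) this(1)] show ?thesis
    unfolding definable_def by auto
qed

lemma all_set_D:
  assumes "P \<in> D" "finite Y" "fst ` Y \<subseteq> {1..k}"
  shows "(\<lambda>v. \<forall>w. P (override_on v w Y)) \<in> D"
  using assms(2,3)
proof (induction Y rule: finite_induct)
  case empty
  then show ?case using assms by simp
next
  case (insert y Y)
  then have "(\<lambda>v. \<forall>w. P (override_on v w Y)) \<in> D" by simp
  from all_D[OF this] have "(\<lambda>v. \<forall>a w. P (override_on (v(y := a)) w Y)) \<in> D"
    using insert.prems by simp
  moreover have "(\<forall>a w. P (override_on (v(y := a)) w Y)) \<longleftrightarrow> (\<forall>w. P (override_on v w (insert y Y)))" for v
  proof -
    have "override_on (v(y := a)) w Y = override_on v (w(y := a)) (insert y Y)"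
      and "override_on v w (insert y Y) = override_on (v(y := w y)) w Y" for a w
      using insert.hyps by (auto simp: override_on_def)
    then show ?thesis by metis
  qed
  ultimately show ?case by simp
qed

lemma eq_D:
  assumes "fst x \<in> {1..k}" "fst x = fst y"
  shows "(\<lambda>v. v x = v y) \<in> D"
proof -
  have "qfm_over k (S \<union> {sigma_bot} \<union> sigma_eq ` {1..k}) (Pred (sigma_eq (fst x)) [x, y])"
    using assms by (auto simp: sigma_eq_def)
  moreover have "(\<lambda>v. v x = v y) = (\<lambda>v. sat v (Pred (sigma_eq (fst x)) [x, y]))"
    by (auto simp: sigma_eq_def)
  ultimately show ?thesis unfolding definable_def by blast
qed

lemma True_D: "(\<lambda>v. True) \<in> D"
  using eq_D[of "(1, 0)" "(1, 0)"] k_pos by simp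

lemma False_D: "(\<lambda>v. False) \<in> D"
proof -
  have "qfm_over k (S \<union> {sigma_bot} \<union> sigma_eq ` {1..k}) (Pred sigma_bot [])"
    "(\<lambda>v. False) = (\<lambda>v. sat v (Pred sigma_bot []))"
    by (auto simp: sigma_bot_def)
  then show ?thesis unfolding definable_def by blast
qed

lemma ball_D:
  assumes "finite A" "\<And>i. i \<in> A \<Longrightarrow> P i \<in> D"
  shows "(\<lambda>v. \<forall>i\<in>A. P i v) \<in> D"
  using assms
proof (induction A rule: finite_induct)
  case empty
  then show ?case using True_D by simp
next
  case (insert i A)
  then have "(\<lambda>v. P i v \<and> (\<forall>i\<in>A. P i v)) \<in> D" by (intro conj_D) auto
  then show ?case by simp
qed

lemma atom_D:
  assumes "R \<in> S" "map fst xs = fst R"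
  shows "(\<lambda>v. map v xs \<in> snd R) \<in> D"
proof -
  have "qfm_over k (S \<union> {sigma_bot} \<union> sigma_eq ` {1..k}) (Pred R xs)" using assms by simp
  moreover have "(\<lambda>v. map v xs \<in> snd R) = (\<lambda>v. sat v (Pred R xs))" by simp
  ultimately show ?thesis unfolding definable_def by blast
qed

text \<open>A formula for \<open>P\<close> may have free variables outside \<open>xs\<close>; as
  \<open>P\<close> does not depend on them, binding them existentially changes nothing, and the
  closure condition on \<open>S\<close> applies to the resulting formula.\<close>

lemma rel_in_clone:
  assumes "P \<in> D" "distinct xs" "fst ` set xs \<subseteq> {1..k}" "depends_on (set xs) P"
  shows "(map fst xs, {map v xs | v. P v}) \<in> S"
proof -
  obtain \<phi> where \<phi>: "qfm_over k (S \<union> {sigma_bot} \<union> sigma_eq ` {1..k}) \<phi>" "P = (\<lambda>v. sat v \<phi>)"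
    using assms by (auto simp: definable_def)
  let ?Y = "free_vars \<phi> - set xs"
  have "fst ` ?Y \<subseteq> {1..k}" using free_vars_sorts[OF \<phi>(1) sorted] by auto
  then obtain \<psi> where \<psi>: "qfm_over k (S \<union> {sigma_bot} \<union> sigma_eq ` {1..k}) \<psi>"
    "free_vars \<psi> = free_vars \<phi> - ?Y" "\<And>v. sat v \<psi> \<longleftrightarrow> (\<exists>w. sat (override_on v w ?Y) \<phi>)"
    using exists_closure[OF _ _ \<phi>(1)] finite_free_vars by (metis finite_Diff)
  have "P (override_on v w ?Y) = P v" for v w
    by (rule depends_onD[OF assms(4)]) simp
  then have "sat v \<psi> = P v" for v using \<psi>(3) \<phi>(2) by simp
  then have "defined_rel xs \<psi> = (map fst xs, {map v xs | v. P v})"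
    by (simp add: defined_rel_def)
  moreover have "defined_rel xs \<psi> \<in> qpp_closure k S"
    unfolding qpp_closure_def using assms \<psi> by blast
  moreover have "qpp_closure k S = S"
    using clone by (simp add: quantified_relational_clones_def)
  ultimately show ?thesis by simp
qed

text \<open>Renaming inside a formula would risk capture. Instead \<open>P\<close> is turned into a
  relation of \<open>S\<close>, which may be applied to any variables of the right sorts; hence
  \<open>f\<close> need not be injective.\<close>

lemma rename_D:
  assumes "P \<in> D" "\<And>x. fst (f x) = fst x"
  shows "(\<lambda>v. P (v \<circ> f)) \<in> D"
proof -
  obtain X where X: "finite X" "fst ` X \<subseteq> {1..k}" "depends_on X P" using support[OF assms(1)] .
  obtain xs where xs: "set xs = X" "distinct xs" using finite_distinct_list[OF X(1)] by blast
  have "(\<lambda>v. map v (map f xs) \<in> {map w xs | w. P w}) \<in> D"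
    using atom_D[OF rel_in_clone[OF assms(1)], of xs "map f xs"] xs X assms(2)
    by (simp add: comp_def)
  moreover have "map v (map f xs) \<in> {map w xs | w. P w} \<longleftrightarrow> P (v \<circ> f)" for v
  proof
    assume "map v (map f xs) \<in> {map w xs | w. P w}"
    then obtain w where w: "map v (map f xs) = map w xs" "P w" by blast
    then have "P (v \<circ> f) = P w" using xs by (intro depends_onD[OF X(3)]) auto
    then show "P (v \<circ> f)" using w by simp
  next
    assume "P (v \<circ> f)"
    then show "map v (map f xs) \<in> {map w xs | w. P w}"
      by (metis (mono_tags, lifting) list.map_comp mem_Collect_eq)
  qed
  ultimately show ?thesis by simp
qed

lemma subst_D:
  assumes "P \<in> D" "fst x = fst y"
  shows "(\<lambda>v. P (v(x := v y))) \<in> D"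
proof -
  have "(\<lambda>v. P (v \<circ> (id(x := y)))) \<in> D" using assms by (intro rename_D) auto
  moreover have "v \<circ> (id(x := y)) = v(x := v y)" for v :: "svar \<Rightarrow> bit" by auto
  ultimately show ?thesis by simp
qed

text \<open>Since \<open>xs\<close> is distinct, every tuple of \<open>R\<close> comes from a
  valuation, so the predicate gives back exactly \<open>R\<close>.\<close>

lemma mem_iff:
  assumes "R \<in> sorted_rels k" "distinct xs" "map fst xs = fst R"
  shows "R \<in> S \<longleftrightarrow> (\<lambda>v. map v xs \<in> snd R) \<in> D"
proof
  assume "R \<in> S"
  then show "(\<lambda>v. map v xs \<in> snd R) \<in> D" using assms atom_D by blast
next
  assume *: "(\<lambda>v. map v xs \<in> snd R) \<in> D"
  have srt: "fst ` set xs \<subseteq> {1..k}"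
  proof -
    have "fst ` set xs = set (fst R)" using assms(3) by (metis image_set)
    then show ?thesis using assms(1) by (auto simp: sorted_rels_def)
  qed
  have len: "length a = length xs" if "a \<in> snd R" for a
  proof -
    have "length (fst R) = length xs" using assms(3) by (metis length_map)
    then show ?thesis using assms(1) that by (auto simp: sorted_rels_def)
  qed
  have "\<exists>v. a = map v xs" if "a \<in> snd R" for a
  proof -
    have "map (\<lambda>x. the (map_of (zip xs a) x)) xs = a"
      using len[OF that] assms(2) by (intro nth_equalityI) (auto simp: map_of_zip_nth)
    then show ?thesis by metis
  qed
  then have "{map v xs | v. map v xs \<in> snd R} = snd R" by blast
  moreover have "depends_on (set xs) (\<lambda>v. map v xs \<in> snd R)"
    unfolding depends_on_def by (simp cong: map_cong)
  ultimately show "R \<in> S"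
    using rel_in_clone[OF * assms(2) srt] assms(3) by simp
qed

end

section \<open>Maximal predicates have affine complements\<close>

lemma bit_sum_override:
  "I \<subseteq> Y \<Longrightarrow> (\<Sum>p\<in>I. override_on v w Y p) = (\<Sum>p\<in>I. w p)"
  "I \<inter> Y = {} \<Longrightarrow> (\<Sum>p\<in>I. override_on v w Y p) = (\<Sum>p\<in>I. v p)"
  by (intro sum.cong; force simp: override_on_def)+


text \<open>Induction on \<open>J\<close>: freezing the coordinate \<open>j\<close> at 0 leaves an
  affine function of the others, and the change in \<open>g\<close> caused by \<open>j\<close> is
  \<open>v j\<close> times a constant.\<close>

lemma affine_bit_form:
  fixes g :: "('a \<Rightarrow> bit) \<Rightarrow> bit"
  assumes "finite J"
    and "\<And>x y z. g (\<lambda>i. x i + y i + z i) = g x + g y + g z"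
    and "\<And>v w. (\<And>i. i \<in> J \<Longrightarrow> v i = w i) \<Longrightarrow> g v = g w"
  shows "\<exists>I\<subseteq>J. \<exists>c. \<forall>v. g v = c + (\<Sum>i\<in>I. v i)"
  using assms
proof (induction J arbitrary: g rule: finite_induct)
  case empty
  then have "g v = g (\<lambda>_. 0) + (\<Sum>i\<in>{}. v i)" for v by (metis add_0_right empty_iff sum.empty)
  then show ?case by blast
next
  case (insert j J)
  let ?h = "\<lambda>v. g (v(j := 0))"
  have "?h (\<lambda>i. x i + y i + z i) = ?h x + ?h y + ?h z" for x y z
  proof -
    have "(\<lambda>i. x i + y i + z i)(j := 0) = (\<lambda>i. (x(j := 0)) i + (y(j := 0)) i + (z(j := 0)) i)" by auto
    then show ?thesis using insert.prems(1) by metis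
  qed
  moreover have "?h v = ?h w" if "\<And>i. i \<in> J \<Longrightarrow> v i = w i" for v w
    by (rule insert.prems(2)) (use that in auto)
  ultimately obtain I c where I: "I \<subseteq> J" "\<And>v. ?h v = c + (\<Sum>i\<in>I. v i)"
    using insert.IH[of ?h] by blast
  define d where "d = g ((\<lambda>_. 0)(j := 1)) + g (\<lambda>_. 0)"
  have step: "g v = ?h v + v j * d" for v
  proof (cases "v j")
    case zero
    then have "v(j := 0) = v" by auto
    then show ?thesis using zero by simp
  next
    case one
    \<comment> \<open>\<open>v\<close> is the sum of its frozen version, the unit vector at
      \<open>j\<close> and the zero vector.\<close>
    then have "(\<lambda>i. (v(j := 0)) i + ((\<lambda>_. 0)(j := 1)) i + 0) = v" by auto
    with insert.prems(1)[of "v(j := 0)" "(\<lambda>_. 0)(j := 1)" "\<lambda>_. 0"]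
    have "g v = ?h v + g ((\<lambda>_. 0)(j := 1)) + g (\<lambda>_. 0)" by (simp only:)
    then show ?thesis using one by (simp add: d_def add.assoc)
  qed
  have fin: "finite I" "j \<notin> I" using I(1) insert.hyps finite_subset by auto
  show ?case
  proof (cases d)
    case zero
    then have "g v = c + (\<Sum>i\<in>I. v i)" for v using I(2)[of v] step[of v] by simp
    then show ?thesis using I(1) by blast
  next
    case one
    then have "g v = c + (\<Sum>i\<in>insert j I. v i)" for v
      using I(2)[of v] step[of v] fin by (simp add: ac_simps)
    moreover have "insert j I \<subseteq> insert j J" using I(1) by blast
    ultimately show ?thesis by blast
  qed
qed

text \<open>\<open>J\<close> is a maximal set of coordinates that vary freely on the affine space where \<open>P\<close> fails;
  this space is then the graph of an affine map from the coordinates in \<open>J\<close> to the remaining ones.\<close>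

lemma affine_complement_form:
  assumes "finite X" and dep: "depends_on X P" and "\<not> P a"
    and aff: "\<And>c d. \<not> P c \<Longrightarrow> \<not> P d \<Longrightarrow> \<not> P (\<lambda>x. a x + c x + d x)"
  obtains J M I e where "J \<inter> M = {}" "J \<union> M = X" "\<And>t. t \<in> M \<Longrightarrow> I t \<subseteq> J"
    "P = (\<lambda>v. \<exists>t\<in>M. v t + (\<Sum>p\<in>I t. v p) = e t)"
proof -
  \<comment> \<open>The hypothesis has the fixed base point \<open>a\<close>; applied twice, it
    introduces \<open>a\<close> twice, which cancels.\<close>
  have aff3: "\<not> P (\<lambda>x. b x + c x + d x)" if "\<not> P b" "\<not> P c" "\<not> P d" for b c d
  proof -
    have "\<not> P (\<lambda>x. a x + b x + (a x + c x + d x))"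
      using aff[OF that(1) aff[OF that(2,3)]] .
    moreover have "a x + b x + (a x + c x + d x) = b x + c x + d x" for x
      by (cases "a x"; cases "b x"; cases "c x"; cases "d x") auto
    ultimately show ?thesis by simp
  qed
  define free where "free J \<longleftrightarrow> (\<forall>y. \<exists>v. \<not> P v \<and> (\<forall>x\<in>J. v x = y x))" for J
  have "free {}" using assms(3) by (auto simp: free_def)
  then have "{J. J \<subseteq> X \<and> free J} \<noteq> {}" by blast
  moreover have "finite {J. J \<subseteq> X \<and> free J}" using assms(1) by simp
  ultimately have "\<exists>J\<in>{J. J \<subseteq> X \<and> free J}. \<forall>J'\<in>{J. J \<subseteq> X \<and> free J}. J \<subseteq> J' \<longrightarrow> J = J'"
    by (rule finite_has_maximal[rotated])
  then obtain J where J: "J \<subseteq> X" "free J" and "\<forall>J'\<in>{J. J \<subseteq> X \<and> free J}. J \<subseteq> J' \<longrightarrow> J = J'"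
    by blast
  then have max: "\<And>J'. J' \<subseteq> X \<Longrightarrow> free J' \<Longrightarrow> J \<subseteq> J' \<Longrightarrow> J' = J"
    by (metis mem_Collect_eq)
  define M where "M = X - J"
  obtain ext where ext: "\<And>y. \<not> P (ext y)" "\<And>y x. x \<in> J \<Longrightarrow> ext y x = y x"
    using J(2) unfolding free_def by metis
  have det: "v t = w t" if "t \<in> M" "\<not> P v" "\<not> P w" "\<And>x. x \<in> J \<Longrightarrow> v x = w x" for t v w
  proof -
    \<comment> \<open>By maximality of \<open>J\<close>, some values \<open>y\<close> on
      \<open>insert t J\<close> are not attained: a failing point that agrees with \<open>y\<close>
      on \<open>J\<close> differs from it at \<open>t\<close>. Both \<open>?u\<close> and the sum of
      \<open>?u\<close>, \<open>v\<close> and \<open>w\<close> are such points, so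
      \<open>v t = w t\<close>.\<close>
    have "\<not> free (insert t J)" using max[of "insert t J"] that(1) J(1) by (auto simp: M_def)
    then obtain y where y: "\<And>v. \<not> P v \<Longrightarrow> (\<And>x. x \<in> J \<Longrightarrow> v x = y x) \<Longrightarrow> v t \<noteq> y t"
      unfolding free_def by blast
    let ?u = "ext y"
    have "?u t \<noteq> y t" by (rule y) (use ext in auto)
    moreover have "?u t + v t + w t \<noteq> y t"
      by (rule y[OF aff3[OF ext(1)[of y] that(2,3)]]) (simp only: ext(2) that(4) add.assoc bit_add_self add_0_right)
    ultimately show ?thesis by (cases "v t"; cases "w t"; cases "y t"; cases "?u t") auto
  qed
  have graph: "\<not> P v \<longleftrightarrow> (\<forall>t\<in>M. v t = ext v t)" for v
  proof
    assume "\<not> P v"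
    then show "\<forall>t\<in>M. v t = ext v t" using det ext by metis
  next
    assume *: "\<forall>t\<in>M. v t = ext v t"
    have "P v = P (ext v)"
    proof (rule depends_onD[OF dep])
      fix x assume "x \<in> X"
      then show "v x = ext v x" using * ext(2)[of x v] by (cases "x \<in> J") (auto simp: M_def)
    qed
    then show "\<not> P v" using ext by simp
  qed
  have "\<exists>I\<subseteq>J. \<exists>c. \<forall>v. ext v t = c + (\<Sum>i\<in>I. v i)" if t: "t \<in> M" for t
  proof (rule affine_bit_form)
    show "finite J" using J(1) assms(1) finite_subset by blast
    show "ext (\<lambda>i. x i + y i + z i) t = ext x t + ext y t + ext z t" for x y z
      by (rule det[OF t ext(1) aff3[OF ext(1)[of x] ext(1)[of y] ext(1)[of z]]])
        (simp add: ext(2))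
    show "ext v t = ext w t" if "\<And>i. i \<in> J \<Longrightarrow> v i = w i" for v w
      by (rule det[OF t]) (auto simp: ext that)
  qed
  then obtain I c where I: "\<And>t. t \<in> M \<Longrightarrow> I t \<subseteq> J"
    and c: "\<And>t v. t \<in> M \<Longrightarrow> ext v t = c t + (\<Sum>i\<in>I t. v i)" by metis
  have "P v \<longleftrightarrow> (\<exists>t\<in>M. v t + (\<Sum>p\<in>I t. v p) = c t + 1)" for v
  proof -
    \<comment> \<open>A bit differs from a value exactly if it equals that value plus 1.\<close>
    have "v t \<noteq> ext v t \<longleftrightarrow> v t + (\<Sum>p\<in>I t. v p) = c t + 1" if "t \<in> M" for t
      unfolding c[OF that]
      by (cases "v t"; cases "\<Sum>p\<in>I t. v p"; cases "c t") auto
    then show ?thesis using graph[of v] by blast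
  qed
  then have "P = (\<lambda>v. \<exists>t\<in>M. v t + (\<Sum>p\<in>I t. v p) = c t + 1)" by (intro HOL.ext) (simp only:)
  then show ?thesis using that[of J M I "\<lambda>t. c t + 1"] I J(1) by (auto simp: M_def)
qed

section \<open>Maximal definable predicates that fail at a given point\<close>

context clone
begin

text \<open>Following Zhuk's analysis of key relations: if \<open>P\<close> is maximal among the definable predicates
  that fail at \<open>a\<close>, then every \<open>c\<close> at which \<open>P\<close> fails can be moved to \<open>a\<close> by a tuple of unary
  functions preserving \<open>P\<close>, since otherwise the set of all images of \<open>c\<close> under such tuples would
  be a strictly larger definable predicate that fails at \<open>a\<close>.  The function at \<open>x\<close> maps
  \<open>c x\<close> to \<open>a x\<close> and the other bit to \<open>b x\<close>.\<close>

lemma maximal_transport: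
  assumes X: "finite X" "fst ` X \<subseteq> {1..k}" and P: "P \<in> D" "depends_on X P"
    and max: "\<And>Q. Q \<in> D \<Longrightarrow> depends_on X Q \<Longrightarrow> (\<And>v. P v \<Longrightarrow> Q v) \<Longrightarrow> \<not> Q a \<Longrightarrow> Q = P"
    and c: "\<not> P c"
  obtains b where "\<And>r. P r \<Longrightarrow> P (\<lambda>x. if r x = c x then a x else b x)"
proof -
  \<comment> \<open>\<open>star x\<close> is a copy of \<open>x\<close> of the same sort; the shift
    exceeds every name in \<open>X\<close>.\<close>
  define N where "N = Suc (Max (insert 0 (snd ` X)))"
  define star :: "svar \<Rightarrow> svar" where "star x = (fst x, snd x + N)" for x
  have star: "fst (star x) = fst x" for x by (simp add: star_def)
  have star_fresh: "star x \<notin> X" for x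
  proof
    assume "star x \<in> X"
    then have "snd (star x) \<le> Max (insert 0 (snd ` X))" using X(1) by (intro Max_ge) auto
    then show False by (simp add: star_def N_def)
  qed
  have star_inj: "inj star" by (auto simp: inj_def star_def prod_eq_iff)
  define A where "A = {r. P r \<and> (\<forall>x. x \<notin> X \<longrightarrow> r x = 0)}"
  have finA: "finite A"
    by (rule finite_subset[OF _ finite_valuations[OF X(1)]]) (auto simp: A_def)
  \<comment> \<open>Each conjunct says that the functions sending \<open>c x\<close> to
    \<open>v x\<close> and the other bit to \<open>v (star x)\<close> map the satisfying tuple
    \<open>r\<close> to a satisfying tuple.\<close>
  define Q0 where "Q0 v \<longleftrightarrow> (\<forall>r\<in>A. P (v \<circ> (\<lambda>x. if r x = c x then x else star x)))" for v
  define Q where "Q v \<longleftrightarrow> (\<exists>w. Q0 (override_on v w (star ` X)))" for v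
  have "Q0 \<in> D" unfolding Q0_def
    by (intro ball_D finA rename_D P(1)) (auto simp: star)
  moreover have "fst ` star ` X \<subseteq> {1..k}" using X(2) by (auto simp: star)
  ultimately have QD: "Q \<in> D" unfolding Q_def by (intro ex_set_D) (use X in auto)
  have Q: "Q v \<longleftrightarrow> (\<exists>b. \<forall>r\<in>A. P (\<lambda>x. if r x = c x then v x else b x))" for v
  proof -
    have eq: "P (override_on v w (star ` X) \<circ> (\<lambda>x. if r x = c x then x else star x)) =
      P (\<lambda>x. if r x = c x then v x else w (star x))" for w r
      by (rule depends_onD[OF P(2)]) (use star_fresh in \<open>auto simp: override_on_def\<close>)
    have "\<exists>w. b = (\<lambda>x. w (star x))" for b :: "svar \<Rightarrow> bit"
      by (rule exI[of _ "\<lambda>y. b (inv star y)"]) (simp add: star_inj)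
    then have "(\<exists>w. R (\<lambda>x. w (star x))) \<longleftrightarrow> (\<exists>b. R b)" for R :: "(svar \<Rightarrow> bit) \<Rightarrow> bool" by metis
    from this[of "\<lambda>b. \<forall>r\<in>A. P (\<lambda>x. if r x = c x then v x else b x)"]
    show ?thesis unfolding Q_def Q0_def eq .
  qed
  have Qdep: "depends_on X Q"
  proof -
    have *: "P (\<lambda>x. if r x = c x then v x else b x) = P (\<lambda>x. if r x = c x then w x else b x)"
      if "\<forall>x\<in>X. v x = w x" for v w b r
      by (rule depends_onD[OF P(2)]) (use that in auto)
    then have "Q v = Q w" if "\<forall>x\<in>X. v x = w x" for v w
      unfolding Q by (simp only: *[OF that])
    then show ?thesis unfolding depends_on_def by blast
  qed
  \<comment> \<open>Constant functions: every satisfying tuple is mapped to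
    \<open>v\<close>.\<close>
  have "Q v" if "P v" for v
  proof -
    have "(\<lambda>x. if r x = c x then v x else v x) = v" for r by auto
    then show ?thesis unfolding Q using that by (intro exI[of _ v]) auto
  qed
  \<comment> \<open>Identity functions map \<open>c\<close> to itself, so \<open>Q\<close> holds at
    \<open>c\<close>, where \<open>P\<close> fails; by maximality \<open>Q\<close> must hold at
    \<open>a\<close>.\<close>
  moreover have "Q c"
  proof -
    have "(\<lambda>x. if r x = c x then c x else c x + 1) = r" for r
    proof
      fix x show "(if r x = c x then c x else c x + 1) = r x" by (cases "r x"; cases "c x") auto
    qed
    then show ?thesis unfolding Q by (intro exI[of _ "\<lambda>x. c x + 1"]) (auto simp: A_def)
  qed
  ultimately have "Q a" using max[OF QD Qdep] c by metis
  then obtain b where b: "\<And>r. r \<in> A \<Longrightarrow> P (\<lambda>x. if r x = c x then a x else b x)"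
    unfolding Q by blast
  have "P (\<lambda>x. if r x = c x then a x else b x)" if "P r" for r
  proof -
    let ?r = "override_on (\<lambda>_. 0) r X"
    have "P ?r = P r" by (rule depends_onD[OF P(2)]) simp
    then have "P (\<lambda>x. if ?r x = c x then a x else b x)"
      using that by (intro b) (auto simp: A_def)
    also have "P (\<lambda>x. if ?r x = c x then a x else b x) = P (\<lambda>x. if r x = c x then a x else b x)"
      by (rule depends_onD[OF P(2)]) simp
    finally show ?thesis .
  qed
  then show ?thesis using that by blast
qed

text \<open>\<open>Q\<close> is chosen with the most satisfying tuples among the definable
  predicates above \<open>P\<close> that fail at \<open>a\<close>. If it held at
  \<open>a + c + d\<close>, the transports moving \<open>c\<close> and \<open>d\<close> to
  \<open>a\<close> would compose to carry that point to \<open>a\<close>.\<close>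

lemma separating_predicate:
  assumes X: "finite X" "fst ` X \<subseteq> {1..k}" and P: "P \<in> D" "depends_on X P" "\<not> P a"
  obtains Q where "Q \<in> D" "depends_on X Q" "\<And>v. P v \<Longrightarrow> Q v" "\<not> Q a"
    "\<And>c d. \<not> Q c \<Longrightarrow> \<not> Q d \<Longrightarrow> \<not> Q (\<lambda>x. a x + c x + d x)"
proof -
  define A :: "(svar \<Rightarrow> bit) set" where "A = {v. \<forall>x. x \<notin> X \<longrightarrow> v x = 0}"
  have finA: "finite A" using finite_valuations[OF X(1)] by (simp add: A_def)
  define cand where "cand Q \<longleftrightarrow> Q \<in> D \<and> depends_on X Q \<and> (\<forall>v. P v \<longrightarrow> Q v) \<and> \<not> Q a" for Q
  have "cand P" using P by (simp add: cand_def)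
  moreover have "\<forall>Q. cand Q \<longrightarrow> card {v\<in>A. Q v} < Suc (card A)"
    by (auto simp: less_Suc_eq_le intro!: card_mono finA)
  ultimately obtain Q where Q: "cand Q" "\<And>Q'. cand Q' \<Longrightarrow> card {v\<in>A. Q' v} \<le> card {v\<in>A. Q v}"
    using ex_has_greatest_nat[of cand P "\<lambda>Q. card {v\<in>A. Q v}" "Suc (card A)"] by blast
  have Qdep: "depends_on X Q" using Q(1) by (simp add: cand_def)
  have max: "Q' = Q" if Q': "Q' \<in> D" "depends_on X Q'" "\<And>v. Q v \<Longrightarrow> Q' v" "\<not> Q' a" for Q'
  proof -
    have "cand Q'" using Q' Q(1) by (auto simp: cand_def)
    then have "{v\<in>A. Q v} = {v\<in>A. Q' v}"
      using Q(2)[of Q'] Q'(3) finA by (intro card_seteq) auto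
    then have eq: "v \<in> A \<Longrightarrow> Q v = Q' v" for v :: "svar \<Rightarrow> bit" by blast
    show ?thesis
    proof
      fix v :: "svar \<Rightarrow> bit"
      let ?v = "override_on (\<lambda>_. 0) v X"
      have "Q' v = Q' ?v" by (rule depends_onD[OF Q'(2)]) simp
      also have "\<dots> = Q ?v" by (rule eq[symmetric]) (auto simp: A_def)
      also have "\<dots> = Q v" by (rule depends_onD[OF Qdep]) simp
      finally show "Q' v = Q v" .
    qed
  qed
  have "\<not> Q (\<lambda>x. a x + c x + d x)" if c: "\<not> Q c" and d: "\<not> Q d" for c d
  proof
    let ?e = "\<lambda>x. a x + c x + d x"
    assume "Q ?e"
    obtain b where b: "\<And>r. Q r \<Longrightarrow> Q (\<lambda>x. if r x = c x then a x else b x)"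
      using maximal_transport[OF X _ Qdep max c] Q(1) by (auto simp: cand_def)
    obtain b' where b': "\<And>r. Q r \<Longrightarrow> Q (\<lambda>x. if r x = d x then a x else b' x)"
      using maximal_transport[OF X _ Qdep max d] Q(1) by (auto simp: cand_def)
    let ?\<Psi> = "\<lambda>r x. if r x = c x then a x else b x" and ?\<Psi>' = "\<lambda>r x. if r x = d x then a x else b' x"
    have "Q (?\<Psi> (?\<Psi> (?\<Psi>' (?\<Psi> ?e))))" by (rule b[OF b[OF b'[OF b[OF \<open>Q ?e\<close>]]]])
    \<comment> \<open>Checked coordinatewise: this order of composition yields \<open>a x\<close>
      whatever the bits \<open>b x\<close> and \<open>b' x\<close> are.\<close>
    also have "?\<Psi> (?\<Psi> (?\<Psi>' (?\<Psi> ?e))) = a"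
    proof
      fix x
      show "?\<Psi> (?\<Psi> (?\<Psi>' (?\<Psi> ?e))) x = a x"
        by (cases "a x"; cases "b x"; cases "b' x"; cases "c x"; cases "d x") auto
    qed
    finally show False using Q(1) by (simp add: cand_def)
  qed
  then show ?thesis using that[of Q] Q(1) by (auto simp: cand_def)
qed

end

section \<open>Disjunctions of equalities\<close>

lemma sum_upd:
  fixes v :: "svar \<Rightarrow> bit"
  assumes "finite I"
  shows "p \<in> I \<Longrightarrow> (\<Sum>q\<in>I. (v(p := a)) q) = a + (\<Sum>q\<in>I - {p}. v q)"
    and "p \<notin> I \<Longrightarrow> (\<Sum>q\<in>I. (v(p := a)) q) = (\<Sum>q\<in>I. v q)"
proof -
  assume "p \<in> I"
  then have "(\<Sum>q\<in>I. (v(p := a)) q) = a + (\<Sum>q\<in>I - {p}. (v(p := a)) q)"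
    by (subst sum.remove[OF assms, of p]) auto
  also have "(\<Sum>q\<in>I - {p}. (v(p := a)) q) = (\<Sum>q\<in>I - {p}. v q)"
    by (intro sum.cong) auto
  finally show "(\<Sum>q\<in>I. (v(p := a)) q) = a + (\<Sum>q\<in>I - {p}. v q)" .
next
  assume "p \<notin> I"
  then show "(\<Sum>q\<in>I. (v(p := a)) q) = (\<Sum>q\<in>I. v q)" by (intro sum.cong) auto
qed

lemma solve_one_bit:
  assumes "finite I" "I \<noteq> {}"
  obtains w :: "'a \<Rightarrow> bit" where "(\<Sum>p\<in>I. w p) = b"
proof -
  obtain p where "p \<in> I" using assms by blast
  then have "(\<Sum>q\<in>I. if q = p then b else 0) = b" using assms by (simp add: sum.delta)
  then show ?thesis using that by blast
qed

text \<open>Two distinct nonzero linear forms over the two-element field are linearly independent,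
  so they attain every pair of values.\<close>

lemma solve_two_bits:
  assumes "finite I" "finite I'" "I \<noteq> {}" "I' \<noteq> {}" "I \<noteq> I'"
  obtains w :: "'a \<Rightarrow> bit" where "(\<Sum>p\<in>I. w p) = b" "(\<Sum>p\<in>I'. w p) = b'"
proof -
  have aux: "\<exists>w :: 'a \<Rightarrow> bit. (\<Sum>p\<in>I. w p) = b \<and> (\<Sum>p\<in>I'. w p) = b'"
    if fin: "finite I" "finite I'" and p: "p \<in> I" "p \<notin> I'" and q: "q \<in> I'" for I I' p q b b'
  proof -
    \<comment> \<open>The value at \<open>q\<close> settles the sum over \<open>I'\<close>; the
      value at \<open>p\<close>, which \<open>I'\<close> does not contain, then corrects the sum
      over \<open>I\<close>.\<close>
    define c where "c = b + (if q \<in> I then b' else 0)"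
    have "(\<Sum>x\<in>I. (if x = q then b' else 0) + (if x = p then c else 0)) = b"
      using fin p by (simp add: sum.distrib sum.delta c_def add.commute add.left_commute)
    moreover have "(\<Sum>x\<in>I'. (if x = q then b' else 0) + (if x = p then c else 0)) = b'"
      using fin p q by (simp add: sum.distrib sum.delta)
    ultimately show ?thesis by blast
  qed
  consider p q where "p \<in> I" "p \<notin> I'" "q \<in> I'" | p q where "p \<in> I'" "p \<notin> I" "q \<in> I"
    using assms by blast
  then show ?thesis
  proof cases
    case 1
    then show ?thesis using aux[OF assms(1,2) 1] that by blast
  next
    case 2
    then show ?thesis using aux[OF assms(2,1) 2] that by blast
  qed
qed

section \<open>Deriving disjunctions of two equalities\<close>

context clone
begin

lemma eq_disj_from_c3_same:
  assumes i: "i \<in> {1..k}"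
    and Y: "\<And>x y z. fst x = i \<Longrightarrow> fst y = i \<Longrightarrow> fst z = i \<Longrightarrow> (\<lambda>v. v x = v y \<or> v y = v z) \<in> D"
    and s: "fst x = i" "fst y = i" "fst u = i" "fst w = i"
  shows "(\<lambda>v. v x = v y \<or> v u = v w) \<in> D"
proof -
  obtain z where z: "fst z = i" "z \<notin> {x, y, u, w}" by (rule fresh_var[of "{x, y, u, w}"]) auto
  obtain z' where z': "fst z' = i" "z' \<notin> {x, y, u, w, z}" by (rule fresh_var[of "{x, y, u, w, z}"]) auto
  \<comment> \<open>If \<open>x\<close> and \<open>y\<close> differ, then \<open>z = y\<close> and
    \<open>z' = x\<close> differ too, so they cannot both equal \<open>u\<close>, which forces
    \<open>u = w\<close>. If \<open>x = y\<close>, take both to be \<open>u\<close>; if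
    \<open>u = w\<close>, take \<open>z = y\<close> and \<open>z' = x\<close>.\<close>
  have "(\<lambda>v. (v x = v y \<or> v y = v z) \<and> (v y = v x \<or> v x = v z') \<and>
    (v z = v u \<or> v u = v w) \<and> (v z' = v u \<or> v u = v w)) \<in> D" (is "?B \<in> D")
    by (intro conj_D Y s z z')
  then have "(\<lambda>v. \<exists>a a'. ?B (v(z := a, z' := a'))) \<in> D"
    using i z z' by (intro ex_D) auto
  moreover have "(\<exists>a a'. ?B (v(z := a, z' := a'))) \<longleftrightarrow> v x = v y \<or> v u = v w" for v
    using z(2) z'(2) unfolding ex_bit
    by (cases "v x"; cases "v y"; cases "v u"; cases "v w") auto
  ultimately show ?thesis by simp
qed

text \<open>Fresh copies \<open>t'\<close> and \<open>s'\<close> solving the two equations turn the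
  equations for \<open>t\<close> and \<open>s\<close> into equalities when \<open>J\<close> is
  eliminated. This needs independent sums; if \<open>I = I'\<close>, elimination links the two sorts
  by \<open>v t + v s = d\<close>, and the disjunction is derived within the sort of
  \<open>t\<close> and carried to the sort of \<open>s\<close>.\<close>

lemma eq_disj_from_linear_disj:
  assumes fin: "finite J" and sub: "I \<subseteq> J" "I' \<subseteq> J" and ne: "I \<noteq> {}" "I' \<noteq> {}"
    and nt: "t \<notin> J" "s \<notin> J" "t \<noteq> s"
    and srt: "fst ` (insert t (insert s J)) \<subseteq> {1..k}"
    and AB: "(\<lambda>v. v t + (\<Sum>p\<in>I. v p) = e \<or> v s + (\<Sum>p\<in>I'. v p) = e') \<in> D"
    and A: "(\<lambda>v. v t + (\<Sum>p\<in>I. v p) = e) \<in> D"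
    and B: "(\<lambda>v. v s + (\<Sum>p\<in>I'. v p) = e') \<in> D"
    and xs: "fst x = fst t" "fst x' = fst t" "fst u = fst s" "fst u' = fst s"
  shows "(\<lambda>v. v x = v x' \<or> v u = v u') \<in> D"
proof (cases "I = I'")
  case False
  obtain t' where t': "fst t' = fst t" "t' \<notin> insert t (insert s J)"
    using fin by (metis finite_insert fresh_var)
  obtain s' where s': "fst s' = fst s" "s' \<notin> insert t' (insert t (insert s J))"
    using fin by (metis finite_insert fresh_var)
  have nI: "t \<notin> I" "t' \<notin> I" "s \<notin> I'" "s' \<notin> I'" using sub nt t' s' by auto
  have finI: "finite I" "finite I'" using sub fin finite_subset by auto
  have A': "(\<lambda>v. v t' + (\<Sum>p\<in>I. v p) = e) \<in> D"
    using subst_D[OF A t'(1)[symmetric]] by (simp add: sum_upd finI nI fun_upd_same del: fun_upd_apply)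
  have B': "(\<lambda>v. v s' + (\<Sum>p\<in>I'. v p) = e') \<in> D"
    using subst_D[OF B s'(1)[symmetric]] by (simp add: sum_upd finI nI fun_upd_same del: fun_upd_apply)
  let ?Q = "\<lambda>v. (v t + (\<Sum>p\<in>I. v p) = e \<or> v s + (\<Sum>p\<in>I'. v p) = e') \<and>
    v t' + (\<Sum>p\<in>I. v p) = e \<and> v s' + (\<Sum>p\<in>I'. v p) = e'"
  have "?Q \<in> D" by (intro conj_D AB A' B')
  then have "(\<lambda>v. \<exists>w. ?Q (override_on v w J)) \<in> D"
    using fin srt by (intro ex_set_D) auto
  moreover have "(\<exists>w. ?Q (override_on v w J)) \<longleftrightarrow> v t = v t' \<or> v s = v s'" for v
  proof -
    have Q: "?Q (override_on v w J) \<longleftrightarrow>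
      (v t + (\<Sum>p\<in>I. w p) = e \<or> v s + (\<Sum>p\<in>I'. w p) = e') \<and>
      v t' + (\<Sum>p\<in>I. w p) = e \<and> v s' + (\<Sum>p\<in>I'. w p) = e'" for w
      using nt t' s' by (simp add: bit_sum_override(1) sub)
    \<comment> \<open>The copies prescribe the values of both sums; these are attained since
      \<open>I\<close> and \<open>I'\<close> differ.\<close>
    obtain w where w: "(\<Sum>p\<in>I. w p) = v t' + e" "(\<Sum>p\<in>I'. w p) = v s' + e'"
      using solve_two_bits[OF finI ne False] by metis
    show ?thesis
    proof
      assume "\<exists>w. ?Q (override_on v w J)"
      then show "v t = v t' \<or> v s = v s'" unfolding Q by (metis add_right_cancel)
    next
      assume "v t = v t' \<or> v s = v s'"
      then have "?Q (override_on v w J)" unfolding Q w by (auto simp flip: add.assoc)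
      then show "\<exists>w. ?Q (override_on v w J)" by blast
    qed
  qed
  ultimately have "(\<lambda>v. v t = v t' \<or> v s = v s') \<in> D" by simp
  then have "(\<lambda>v. (\<lambda>v. v t = v t' \<or> v s = v s') (v \<circ> id(t := x, t' := x', s := u, s' := u'))) \<in> D"
    by (rule rename_D) (use xs t' s' in auto)
  moreover have "t \<noteq> t'" "t \<noteq> s'" "t' \<noteq> s" "t' \<noteq> s'" "s \<noteq> s'" using t' s' by auto
  ultimately show ?thesis using nt by simp
next
  case True
  define d where "d = e + e'"
  have finI: "finite I" using sub fin finite_subset by auto
  have sk: "fst t \<in> {1..k}" "fst s \<in> {1..k}" using srt by auto
  have sumJ: "(\<exists>w. R (\<Sum>p\<in>I. w p)) \<longleftrightarrow> (\<exists>b. R b)" for R :: "bit \<Rightarrow> bool"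
    using solve_one_bit[OF finI ne(1)] by metis
  have N0: "(\<lambda>v. v t + v s = d) \<in> D"
  proof -
    have "(\<lambda>v. v t + (\<Sum>p\<in>I. v p) = e \<and> v s + (\<Sum>p\<in>I'. v p) = e') \<in> D" (is "?Q \<in> D")
      by (intro conj_D A B)
    then have "(\<lambda>v. \<exists>w. ?Q (override_on v w J)) \<in> D"
      using fin srt by (intro ex_set_D) auto
    moreover have "(\<exists>w. ?Q (override_on v w J)) \<longleftrightarrow> v t + v s = d" for v
    proof -
      have "?Q (override_on v w J) \<longleftrightarrow> v t + (\<Sum>p\<in>I. w p) = e \<and> v s + (\<Sum>p\<in>I. w p) = e'" for w
        using nt by (simp add: bit_sum_override(1) sub flip: True)
      then have "(\<exists>w. ?Q (override_on v w J)) \<longleftrightarrow> (\<exists>b. v t + b = e \<and> v s + b = e')"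
        using sumJ[of "\<lambda>b. v t + b = e \<and> v s + b = e'"] by simp
      also have "\<dots> \<longleftrightarrow> v t + v s = d" unfolding ex_bit d_def
        by (cases "v t"; cases "v s"; cases e; cases e') auto
      finally show ?thesis .
    qed
    ultimately show ?thesis by simp
  qed
  have N: "(\<lambda>v. v y + v z = d) \<in> D" if "fst y = fst t" "fst z = fst s" for y z
  proof -
    have "(\<lambda>v. (\<lambda>v. v t + v s = d) (v \<circ> id(t := y, s := z))) \<in> D"
      by (rule rename_D[OF N0]) (use that in auto)
    then show ?thesis using nt by simp
  qed
  obtain t' where t': "fst t' = fst t" "t' \<notin> insert t (insert s J)"
    using fin by (metis finite_insert fresh_var)
  have nI: "t \<notin> I" "t' \<notin> I" using sub nt t' by auto
  have A': "(\<lambda>v. v t' + (\<Sum>p\<in>I. v p) = e) \<in> D"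
    using subst_D[OF A t'(1)[symmetric]] by (simp add: sum_upd finI nI fun_upd_same del: fun_upd_apply)
  have Z0: "(\<lambda>v. v t = v t' \<or> v s = v t' + d) \<in> D"
  proof -
    have "(\<lambda>v. (v t + (\<Sum>p\<in>I. v p) = e \<or> v s + (\<Sum>p\<in>I'. v p) = e') \<and> v t' + (\<Sum>p\<in>I. v p) = e) \<in> D" (is "?Q \<in> D")
      by (intro conj_D AB A')
    then have "(\<lambda>v. \<exists>w. ?Q (override_on v w J)) \<in> D"
      using fin srt by (intro ex_set_D) auto
    moreover have "(\<exists>w. ?Q (override_on v w J)) \<longleftrightarrow> v t = v t' \<or> v s = v t' + d" for v
    proof -
      have "?Q (override_on v w J) \<longleftrightarrow>
        (v t + (\<Sum>p\<in>I. w p) = e \<or> v s + (\<Sum>p\<in>I. w p) = e') \<and> v t' + (\<Sum>p\<in>I. w p) = e" for w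
        using nt t' by (simp add: bit_sum_override(1) sub flip: True)
      then have "(\<exists>w. ?Q (override_on v w J)) \<longleftrightarrow> (\<exists>b. (v t + b = e \<or> v s + b = e') \<and> v t' + b = e)"
        using sumJ[of "\<lambda>b. (v t + b = e \<or> v s + b = e') \<and> v t' + b = e"] by simp
      also have "\<dots> \<longleftrightarrow> v t = v t' \<or> v s = v t' + d" unfolding ex_bit d_def
        by (cases "v t"; cases "v s"; cases "v t'"; cases e; cases e') auto
      finally show ?thesis .
    qed
    ultimately show ?thesis by simp
  qed
  have Z: "(\<lambda>v. v y = v y' \<or> v z = v y' + d) \<in> D" if "fst y = fst t" "fst y' = fst t" "fst z = fst s" for y y' z
  proof -
    have "(\<lambda>v. (\<lambda>v. v t = v t' \<or> v s = v t' + d) (v \<circ> id(t := y, t' := y', s := z))) \<in> D"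
      by (rule rename_D[OF Z0]) (use that t' in auto)
    moreover have "t \<noteq> t'" "t' \<noteq> s" using t' by auto
    ultimately show ?thesis using nt by simp
  qed
  have Y: "(\<lambda>v. v a = v b \<or> v b = v c) \<in> D" if abc: "fst a = fst t" "fst b = fst t" "fst c = fst t" for a b c
  proof -
    obtain z where z: "fst z = fst s" "z \<notin> {a, b, c}" by (rule fresh_var[of "{a, b, c}"]) auto
    \<comment> \<open>\<open>z\<close> is a copy of \<open>c\<close> in the sort of
      \<open>s\<close>: \<open>v z = v c + d\<close>.\<close>
    have "(\<lambda>v. (v a = v b \<or> v z = v b + d) \<and> v c + v z = d) \<in> D" (is "?Q \<in> D")
      by (intro conj_D Z N abc z)
    then have "(\<lambda>v. \<exists>m. ?Q (v(z := m))) \<in> D" using sk z by (intro ex_D) auto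
    moreover have "(\<exists>m. ?Q (v(z := m))) \<longleftrightarrow> v a = v b \<or> v b = v c" for v
      using z(2) unfolding ex_bit by (cases "v a"; cases "v b"; cases "v c"; cases d) auto
    ultimately show ?thesis by simp
  qed
  obtain z where z: "fst z = fst t" "z \<notin> {x, x', u, u'}" by (rule fresh_var[of "{x, x', u, u'}"]) auto
  obtain z' where z': "fst z' = fst t" "z' \<notin> {x, x', u, u', z}" by (rule fresh_var[of "{x, x', u, u', z}"]) auto
  \<comment> \<open>\<open>z\<close> and \<open>z'\<close> stand for \<open>u\<close> and
    \<open>u'\<close> in the sort of \<open>t\<close>, shifted by \<open>d\<close>.\<close>
  have "(\<lambda>v. (v x = v x' \<or> v z = v z') \<and> v z + v u = d \<and> v z' + v u' = d) \<in> D" (is "?Q \<in> D")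
    by (intro conj_D N eq_disj_from_c3_same[OF sk(1) Y] xs z z')
  then have "(\<lambda>v. \<exists>m m'. ?Q (v(z := m, z' := m'))) \<in> D" using sk z z' by (intro ex_D) auto
  moreover have "(\<exists>m m'. ?Q (v(z := m, z' := m'))) \<longleftrightarrow> v x = v x' \<or> v u = v u'" for v
    using z(2) z'(2) unfolding ex_bit
    by (cases "v x"; cases "v x'"; cases "v u"; cases "v u'"; cases d) auto
  ultimately show ?thesis by simp
qed

end

section \<open>Linear equations\<close>

lemma sum_list_unit: "p < n \<Longrightarrow> sum_list ((replicate n 0)[p := c]) = (c :: 'a :: comm_monoid_add)"
proof (induction n arbitrary: p)
  case (Suc n)
  have "sum_list (replicate n (0 :: 'a)) = 0" by (induction n) auto
  then show ?case using Suc by (auto split: nat.split)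
qed simp

text \<open>The hypotheses are one-sided and lead to \<open>S \<subseteq> T\<close>. Disjunctions of
  literals are assumed to transfer as predicates; the counting vectors supply this later.\<close>

locale clone_pair = S: clone k S + T: clone k T for k S T +
  assumes canonical: "S \<inter> CR_1_6 k \<subseteq> T"
    and literals: "\<And>M e. finite M \<Longrightarrow> fst ` M \<subseteq> {1..k} \<Longrightarrow>
      (\<lambda>v. \<exists>t\<in>M. v t = e t) \<in> S.D \<Longrightarrow> (\<lambda>v. \<exists>t\<in>M. v t = e t) \<in> T.D"
begin

text \<open>The instance at distinct \<open>xs\<close> puts the relation into \<open>S\<close>. By
  \<open>nd\<close> it has no dummy variables, so it is canonical and lies in \<open>T\<close>,
  where it may be applied to any \<open>ys\<close>, even with repetitions.\<close>

lemma canonical_transfer: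
  assumes shape: "(s, A) \<in> canonical_shapes k"
    and len: "A \<subseteq> {a. length a = length s}"
    and nd: "\<And>p. p < length s \<Longrightarrow> \<exists>a c. length a = length s \<and> a \<in> A \<and> a[p := c] \<notin> A"
    and xs: "distinct xs" "map fst xs = s" "set s \<subseteq> {1..k}" "(\<lambda>v. map v xs \<in> A) \<in> S.D"
    and ys: "map fst ys = s"
  shows "(\<lambda>v. map v ys \<in> A) \<in> T.D"
proof -
  have srt: "(s, A) \<in> sorted_rels k" using len xs(3) by (simp add: sorted_rels_def)
  have "eq_up_to_order (s, A) (s, A)"
    unfolding eq_up_to_order_def by (intro exI[of _ id]) (simp add: permutes_id)
  moreover have "\<not> dummy (s, A) p" for p
    unfolding dummy_def using nd[of p] by auto
  ultimately have "(s, A) \<in> CR_1_6 k" using shape srt by (auto simp: CR_1_6_def)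
  moreover have "(s, A) \<in> S" using S.mem_iff[OF srt xs(1)] xs by simp
  ultimately have "(s, A) \<in> T" using canonical by blast
  from T.atom_D[OF this, of ys] ys show ?thesis by simp
qed

lemma c2_transfer:
  assumes ij: "i \<in> {1..k}" "j \<in> {1..k}"
    and D: "\<And>x y u. fst x = i \<Longrightarrow> fst y = i \<Longrightarrow> fst u = j \<Longrightarrow> (\<lambda>v. v x = v y \<or> v u = b) \<in> S.D"
    and xs: "fst x = i" "fst y = i" "fst u = j"
  shows "(\<lambda>v. v x = v y \<or> v u = b) \<in> T.D"
proof -
  let ?A = "{[x, y, u] | x y u :: bit. x = y \<or> u = b}"
  have "(\<lambda>v. map v [x, y, u] \<in> ?A) \<in> T.D"
  proof (rule canonical_transfer)
    show "([i, i, j], ?A) \<in> canonical_shapes k" using ij by (rule c2)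
    show "\<exists>a c. length a = length [i, i, j] \<and> a \<in> ?A \<and> a[p := c] \<notin> ?A"
      if p: "p < length [i, i, j]" for p
    proof -
      \<comment> \<open>The chosen tuple satisfies just one disjunct, and changing entry
        \<open>p\<close> breaks it.\<close>
      consider "p = 0" | "p = 1" | "p = 2" using p by fastforce
      then show ?thesis
      proof cases
        case 1 then show ?thesis by (intro exI[of _ "[0, 0, b + 1]"] exI[of _ 1]) (cases b; simp)
      next
        case 2 then show ?thesis by (intro exI[of _ "[0, 0, b + 1]"] exI[of _ 1]) (cases b; simp)
      next
        case 3 then show ?thesis by (intro exI[of _ "[0, 1, b]"] exI[of _ "b + 1"]) (cases b; simp)
      qed
    qed
    show "(\<lambda>v. map v [(i, 0), (i, 1), (j, 2)] \<in> ?A) \<in> S.D" using D[of "(i, 0)" "(i, 1)" "(j, 2)"] by simp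
  qed (use ij xs in auto)
  then show ?thesis by simp
qed

text \<open>For \<open>i = j\<close> the canonical relation has only three variables; it arises by
  identifying \<open>y\<close> with \<open>u\<close>, and \<open>eq_disj_from_c3_same\<close>
  restores the four variables.\<close>

lemma c3_transfer:
  assumes ij: "i \<in> {1..k}" "j \<in> {1..k}"
    and D: "\<And>x y u w. fst x = i \<Longrightarrow> fst y = i \<Longrightarrow> fst u = j \<Longrightarrow> fst w = j \<Longrightarrow>
      (\<lambda>v. v x = v y \<or> v u = v w) \<in> S.D"
    and xs: "fst x = i" "fst y = i" "fst u = j" "fst w = j"
  shows "(\<lambda>v. v x = v y \<or> v u = v w) \<in> T.D"
proof (cases "i = j")
  case False
  let ?A = "{[x, y, u, w] | x y u w :: bit. x = y \<or> u = w}"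
  have "(\<lambda>v. map v [x, y, u, w] \<in> ?A) \<in> T.D"
  proof (rule canonical_transfer)
    show "([i, i, j, j], ?A) \<in> canonical_shapes k" using ij False by (rule c3_diff)
    show "\<exists>a c. length a = length [i, i, j, j] \<and> a \<in> ?A \<and> a[p := c] \<notin> ?A"
      if p: "p < length [i, i, j, j]" for p
    proof -
      consider "p = 0" | "p = 1" | "p = 2" | "p = 3" using p by fastforce
      then show ?thesis
      proof cases
        case 1 then show ?thesis by (intro exI[of _ "[0, 0, 0, 1]"] exI[of _ 1]) simp
      next
        case 2 then show ?thesis by (intro exI[of _ "[0, 0, 0, 1]"] exI[of _ 1]) simp
      next
        case 3 then show ?thesis by (intro exI[of _ "[0, 1, 0, 0]"] exI[of _ 1]) simp
      next
        case 4 then show ?thesis by (intro exI[of _ "[0, 1, 0, 0]"] exI[of _ 1]) simp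
      qed
    qed
    show "(\<lambda>v. map v [(i, 0), (i, 1), (j, 2), (j, 3)] \<in> ?A) \<in> S.D"
      using D[of "(i, 0)" "(i, 1)" "(j, 2)" "(j, 3)"] by simp
  qed (use ij xs in auto)
  then show ?thesis by simp
next
  case True
  let ?A = "{[x, y, z] | x y z :: bit. x = y \<or> y = z}"
  have Y: "(\<lambda>v. v a = v b \<or> v b = v c) \<in> T.D" if "fst a = i" "fst b = i" "fst c = i" for a b c
  proof -
    have "(\<lambda>v. map v [a, b, c] \<in> ?A) \<in> T.D"
    proof (rule canonical_transfer)
      show "([i, i, i], ?A) \<in> canonical_shapes k" using ij(1) by (rule c3_same)
      show "\<exists>a c. length a = length [i, i, i] \<and> a \<in> ?A \<and> a[p := c] \<notin> ?A"
        if p: "p < length [i, i, i]" for p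
      proof -
        consider "p = 0" | "p = 1" | "p = 2" using p by fastforce
        then show ?thesis
        proof cases
          case 1 then show ?thesis by (intro exI[of _ "[0, 0, 1]"] exI[of _ 1]) simp
        next
          case 2 then show ?thesis by (intro exI[of _ "[0, 0, 0]"] exI[of _ 1]) simp
        next
          case 3 then show ?thesis by (intro exI[of _ "[1, 0, 0]"] exI[of _ 1]) simp
        qed
      qed
      show "(\<lambda>v. map v [(i, 0), (i, 1), (i, 2)] \<in> ?A) \<in> S.D"
        using D[of "(i, 0)" "(i, 1)" "(i, 1)" "(i, 2)"] True by simp
    qed (use ij that in auto)
    then show ?thesis by simp
  qed
  show ?thesis by (rule T.eq_disj_from_c3_same[OF ij(1) Y]) (use xs True in auto)
qed

text \<open>Induction on the number of variables. With pairwise distinct sorts the equation is of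
  type (c6), unless it has at most one variable. Two variables \<open>p\<close> and \<open>q\<close>
  of one sort cancel when identified, which leaves a shorter equation, and type (c5) restores them;
  if there are no other variables, the equation is an equality or of type (c4).\<close>

lemma linear_transfer:
  assumes "finite I" "fst ` I \<subseteq> {1..k}" "(\<lambda>v. (\<Sum>p\<in>I. v p) = b) \<in> S.D"
  shows "(\<lambda>v. (\<Sum>p\<in>I. v p) = b) \<in> T.D"
  using assms
proof (induction "card I" arbitrary: I rule: less_induct)
  case less
  note finI = less.prems(1) and srt = less.prems(2) and LS = less.prems(3)
  show ?case
  proof (cases "inj_on fst I")
    case True
    consider "card I = 0" | "card I = 1" | "card I \<ge> 2" by linarith
    then show ?thesis
    proof cases
      case 1
      then have "I = {}" using finI by simp
      then show ?thesis using T.True_D T.False_D by (cases "b = 0") auto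
    next
      case 2
      then obtain p where "I = {p}" by (auto simp: card_1_singleton_iff)
      then show ?thesis using literals[of I "\<lambda>_. b"] LS srt by simp
    next
      case 3
      obtain xs where xs: "set xs = I" "distinct xs" using finite_distinct_list[OF finI] by blast
      let ?s = "map fst xs"
      let ?A = "{a :: bit list. length a = length ?s \<and> sum_list a = b}"
      have eq: "map v xs \<in> ?A \<longleftrightarrow> (\<Sum>p\<in>I. v p) = b" for v
        using xs by (simp add: sum_list_distinct_conv_sum_set)
      have ds: "distinct ?s" using xs True by (simp add: distinct_map)
      have lx: "length xs \<ge> 2" using 3 xs by (metis distinct_card)
      have ss: "set ?s \<subseteq> {1..k}" using xs srt by simp
      have "(\<lambda>v. map v xs \<in> ?A) \<in> T.D"
      proof (rule canonical_transfer)
        show "(?s, ?A) \<in> canonical_shapes k" using ss ds lx by (intro c6) auto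
        show "\<exists>a c. length a = length ?s \<and> a \<in> ?A \<and> a[p := c] \<notin> ?A" if p: "p < length ?s" for p
        proof -
          have "sum_list ((replicate (length ?s) 0)[p := c]) = c" for c :: bit
            using p by (rule sum_list_unit)
          then show ?thesis
            by (intro exI[of _ "(replicate (length ?s) 0)[p := b]"] exI[of _ "b + 1"]) simp
        qed
        show "(\<lambda>v. map v xs \<in> ?A) \<in> S.D" unfolding eq by (rule LS)
      qed (use xs ss in auto)
      then show ?thesis unfolding eq .
    qed
  next
    case False
    then obtain p q where pq: "p \<in> I" "q \<in> I" "p \<noteq> q" "fst p = fst q" by (auto simp: inj_on_def)
    define I' where "I' = I - {p} - {q}"
    have split: "(\<Sum>x\<in>I. v x) = v p + v q + (\<Sum>x\<in>I'. v x)" for v :: "svar \<Rightarrow> bit"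
      using finI pq by (simp add: I'_def sum.remove[of I p] sum.remove[of "I - {p}" q] add.assoc)
    have finI': "finite I'" using finI by (simp add: I'_def)
    have pk: "fst p \<in> {1..k}" using srt pq by auto
    show ?thesis
    proof (cases "I' = {}")
      case True
      show ?thesis
      proof (cases "b = 0")
        case True
        have "(\<lambda>v. v p = v q) \<in> T.D" using pk pq by (intro T.eq_D)
        moreover have "(\<Sum>x\<in>I. v x) = b \<longleftrightarrow> v p = v q" for v
          using split[of v] \<open>I' = {}\<close> True by (cases "v p"; cases "v q") auto
        ultimately show ?thesis by simp
      next
        case False
        let ?A = "{[x, y] | x y :: bit. x + y = 1}"
        have eq: "map v [p, q] \<in> ?A \<longleftrightarrow> (\<Sum>x\<in>I. v x) = b" for v
          using split[of v] \<open>I' = {}\<close> False by simp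
        have "(\<lambda>v. map v [p, q] \<in> ?A) \<in> T.D"
        proof (rule canonical_transfer)
          show "([fst p, fst p], ?A) \<in> canonical_shapes k" using pk by (rule c4)
          show "\<exists>a c. length a = length [fst p, fst p] \<and> a \<in> ?A \<and> a[x := c] \<notin> ?A"
            if x: "x < length [fst p, fst p]" for x
          proof -
            consider "x = 0" | "x = 1" using x by fastforce
            then show ?thesis
            proof cases
              case 1 then show ?thesis by (intro exI[of _ "[0, 1]"] exI[of _ 1]) simp
            next
              case 2 then show ?thesis by (intro exI[of _ "[0, 1]"] exI[of _ 0]) simp
            qed
          qed
          show "(\<lambda>v. map v [p, q] \<in> ?A) \<in> S.D" unfolding eq by (rule LS)
        qed (use pk pq in auto)
        then show ?thesis unfolding eq .
      qed
    next
      case False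
      then obtain r where r: "r \<in> I'" by blast
      have rk: "fst r \<in> {1..k}" and rI: "r \<in> I" "r \<noteq> p" "r \<noteq> q" using r srt by (auto simp: I'_def)
      have nI': "p \<notin> I'" "q \<notin> I'" by (auto simp: I'_def)
      have "(\<lambda>v. (\<Sum>x\<in>I'. v x) = b) \<in> S.D"
        using S.subst_D[OF LS pq(4)] pq(3) unfolding split
        by (simp add: sum_upd finI' nI' del: fun_upd_apply add: fun_upd_same fun_upd_other flip: add.assoc)
      moreover have "card I' < card I"
        using finI pq unfolding I'_def by (metis Diff_subset card_Diff1_less finite_Diff le_less_trans card_mono)
      ultimately have L': "(\<lambda>v. (\<Sum>x\<in>I'. v x) = b) \<in> T.D"
        using less.hyps[of I'] finI' srt by (auto simp: I'_def)
      obtain p' where p': "fst p' = fst p" "p' \<notin> I" using finI fresh_var by metis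
      obtain r' where r': "fst r' = fst r" "r' \<notin> insert p' I" using finI by (metis finite_insert fresh_var)
      let ?A = "{[x, y, u, w] | x y u w :: bit. x + y = u + w}"
      have S5: "(\<lambda>v. map v [p, p', r, r'] \<in> ?A) \<in> S.D"
      proof -
        let ?f = "id(p := p', r := r')"
        define Y where "Y = I - {p} - {r}"
        have finY: "finite Y" and neY: "Y \<noteq> {}" using finI pq rI by (auto simp: Y_def)
        have splitY: "(\<Sum>x\<in>I. v x) = v p + v r + (\<Sum>x\<in>Y. v x)" for v :: "svar \<Rightarrow> bit"
          using finI pq rI by (simp add: Y_def sum.remove[of I p] sum.remove[of "I - {p}" r] add.assoc)
        \<comment> \<open>Two copies of the equation share the variables in \<open>Y\<close>;
          eliminating \<open>Y\<close>, which contains \<open>q\<close>, leaves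
          \<open>v p + v r = v p' + v r'\<close>.\<close>
        have "(\<lambda>v. (\<Sum>x\<in>I. v x) = b \<and> (\<Sum>x\<in>I. (v \<circ> ?f) x) = b) \<in> S.D" (is "?Q \<in> _")
          by (intro S.conj_D LS S.rename_D[OF LS]) (use p' r' in auto)
        then have "(\<lambda>v. \<exists>w. ?Q (override_on v w Y)) \<in> S.D"
          by (rule S.ex_set_D[OF _ finY]) (use srt in \<open>auto simp: Y_def\<close>)
        moreover have "(\<exists>w. ?Q (override_on v w Y)) \<longleftrightarrow> map v [p, p', r, r'] \<in> ?A" for v
        proof -
          have "(\<Sum>x\<in>Y. (override_on v w Y \<circ> ?f) x) = (\<Sum>x\<in>Y. w x)" for w
            by (intro sum.cong) (auto simp: Y_def)
          then have "?Q (override_on v w Y) \<longleftrightarrow> v p + v r + (\<Sum>x\<in>Y. w x) = b \<and> v p' + v r' + (\<Sum>x\<in>Y. w x) = b" for w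
            unfolding splitY using p' r' rI by (simp add: bit_sum_override Y_def)
          moreover have "(\<exists>w. R (\<Sum>x\<in>Y. w x)) \<longleftrightarrow> (\<exists>c. R c)" for R :: "bit \<Rightarrow> bool"
            using solve_one_bit[OF finY neY] by metis
          ultimately have "(\<exists>w. ?Q (override_on v w Y)) \<longleftrightarrow> (\<exists>c. v p + v r + c = b \<and> v p' + v r' + c = b)" by simp
          also have "\<dots> \<longleftrightarrow> v p + v p' = v r + v r'" unfolding ex_bit
            by (cases "v p"; cases "v p'"; cases "v r"; cases "v r'"; cases b) auto
          finally show ?thesis by simp
        qed
        ultimately show ?thesis by simp
      qed
      obtain z where z: "fst z = fst r" "z \<notin> I" using finI fresh_var by metis
      have "(\<lambda>v. map v [p, q, r, z] \<in> ?A) \<in> T.D"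
      proof (rule canonical_transfer)
        show "([fst p, fst p, fst r, fst r], ?A) \<in> canonical_shapes k" using pk rk by (rule c5)
        show "\<exists>a c. length a = length [fst p, fst p, fst r, fst r] \<and> a \<in> ?A \<and> a[x := c] \<notin> ?A"
          if x: "x < length [fst p, fst p, fst r, fst r]" for x
        proof -
          consider "x = 0" | "x = 1" | "x = 2" | "x = 3" using x by fastforce
          then show ?thesis
            by cases (intro exI[of _ "[0, 0, 0, 0]"] exI[of _ 1]; simp)+
        qed
        show "(\<lambda>v. map v [p, p', r, r'] \<in> ?A) \<in> S.D" by (rule S5)
      qed (use pk rk pq p' r' rI z in auto)
      then have "(\<lambda>v. v p + v q = v r + v z) \<in> T.D" by simp
      \<comment> \<open>\<open>z\<close> takes the value \<open>v p + v q + v r\<close> and replaces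
        \<open>r\<close> in the shorter equation.\<close>
      then have "(\<lambda>v. v p + v q = v r + v z \<and> (\<Sum>x\<in>I'. (v(r := v z)) x) = b) \<in> T.D" (is "?Q \<in> _")
        by (intro T.conj_D T.subst_D[OF L']) (use z in auto)
      then have "(\<lambda>v. \<exists>m. ?Q (v(z := m))) \<in> T.D" using z rk by (intro T.ex_D) auto
      moreover have "(\<exists>m. ?Q (v(z := m))) \<longleftrightarrow> (\<Sum>x\<in>I. v x) = b" for v
      proof -
        have "z \<notin> I' - {r}" "p \<noteq> z" "q \<noteq> z" "r \<noteq> z" using z pq rI by (auto simp: I'_def)
        then have Q: "?Q (v(z := m)) \<longleftrightarrow> v p + v q = v r + m \<and> m + (\<Sum>x\<in>I' - {r}. v x) = b" for m
          using z pq rI finI' r by (auto simp: sum_upd simp del: fun_upd_apply simp add: fun_upd_same fun_upd_other)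
        have "(\<exists>m. a = c + m \<and> m + d = b) \<longleftrightarrow> a + (c + d) = b" for a c d :: bit
          unfolding ex_bit by (cases a; cases b; cases c; cases d) auto
        then have "(\<exists>m. ?Q (v(z := m))) \<longleftrightarrow> v p + v q + (v r + (\<Sum>x\<in>I' - {r}. v x)) = b"
          unfolding Q .
        then show ?thesis using split[of v] r finI' by (simp add: sum.remove[of I' r])
      qed
      ultimately show ?thesis by simp
    qed
  qed
qed

end

section \<open>Disjunctions of linear equations\<close>

context clone
begin

text \<open>Each \<open>t\<close> in \<open>M\<close> occurs in its own equation only, so a
  universally quantified \<open>t\<close> can be chosen to falsify it, and the disjunct
  disappears.\<close>

lemma affine_disj_subset:
  assumes fin: "finite M" and srt: "fst ` M \<subseteq> {1..k}" and JM: "J \<inter> M = {}"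
    and sub: "\<And>t. t \<in> M \<Longrightarrow> I t \<subseteq> J"
    and P: "(\<lambda>v. \<exists>t\<in>M. v t + (\<Sum>p\<in>I t. v p) = e t) \<in> D" (is "?P \<in> D")
    and M': "M' \<subseteq> M"
  shows "(\<lambda>v. \<exists>t\<in>M'. v t + (\<Sum>p\<in>I t. v p) = e t) \<in> D"
proof -
  let ?A = "\<lambda>v t. v t + (\<Sum>p\<in>I t. v p) = e t"
  have "(\<lambda>v. \<forall>w. ?P (override_on v w (M - M'))) \<in> D"
    by (rule all_set_D[OF P]) (use fin srt in auto)
  moreover have "(\<forall>w. ?P (override_on v w (M - M'))) \<longleftrightarrow> (\<exists>t\<in>M'. ?A v t)" for v
  proof -
    have sums: "(\<Sum>p\<in>I t. override_on v w (M - M') p) = (\<Sum>p\<in>I t. v p)" if "t \<in> M" for t w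
      using sub[OF that] JM by (intro bit_sum_override) blast
    have in': "?A (override_on v w (M - M')) t \<longleftrightarrow> ?A v t" if "t \<in> M'" for t w
      using that M' sums[of t w] by auto
    show ?thesis
    proof
      let ?w = "\<lambda>t. e t + (\<Sum>p\<in>I t. v p) + 1"
      assume "\<forall>w. ?P (override_on v w (M - M'))"
      then obtain t where t: "t \<in> M" "?A (override_on v ?w (M - M')) t" by blast
      have "t \<in> M'"
      proof (rule ccontr)
        assume "t \<notin> M'"
        then have "e t + (\<Sum>p\<in>I t. v p) + 1 + (\<Sum>p\<in>I t. v p) = e t"
          using t sums[OF t(1), of ?w] by simp
        then show False by (cases "\<Sum>p\<in>I t. v p"; cases "e t") auto
      qed
      then show "\<exists>t\<in>M'. ?A v t" using in' t(2) by blast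
    next
      assume "\<exists>t\<in>M'. ?A v t"
      then show "\<forall>w. ?P (override_on v w (M - M'))" using in' M' by blast
    qed
  qed
  ultimately show ?thesis by simp
qed

end

section \<open>Transfer of disjunctions of linear equations and of arbitrary predicates\<close>

context clone_pair
begin

text \<open>An equation \<open>t1\<close> with nonempty \<open>I t1\<close> serves as connector: for
  each other \<open>s\<close>, \<open>link\<close> provides the disjunction of
  \<open>v x = v y\<close> and the equation for \<open>s\<close>; \<open>chain\<close> composes
  these; at last \<open>v x = v y\<close> is replaced by the equation for \<open>t1\<close>.\<close>

lemma affine_disj_transfer:
  assumes fin: "finite M" "finite J" and srt: "fst ` M \<subseteq> {1..k}" "fst ` J \<subseteq> {1..k}"
    and JM: "J \<inter> M = {}" and sub: "\<And>t. t \<in> M \<Longrightarrow> I t \<subseteq> J"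
    and P: "(\<lambda>v. \<exists>t\<in>M. v t + (\<Sum>p\<in>I t. v p) = e t) \<in> S.D"
  shows "(\<lambda>v. \<exists>t\<in>M. v t + (\<Sum>p\<in>I t. v p) = e t) \<in> T.D"
proof (cases "\<forall>t\<in>M. I t = {}")
  case True
  then have eq: "(\<exists>t\<in>M. v t + (\<Sum>p\<in>I t. v p) = e t) \<longleftrightarrow> (\<exists>t\<in>M. v t = e t)" for v :: "svar \<Rightarrow> bit"
    by auto
  show ?thesis using P unfolding eq by (rule literals[OF fin(1) srt(1)])
next
  case False
  then obtain t1 where t1: "t1 \<in> M" "I t1 \<noteq> {}" by blast
  define A where "A t v \<longleftrightarrow> v t + (\<Sum>p\<in>I t. v p) = e t" for t v
  have finI: "finite (I t)" if "t \<in> M" for t using sub[OF that] fin(2) finite_subset by blast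
  have nI: "s \<notin> I t" if "t \<in> M" "s \<in> M" for s t using sub[OF that(1)] that(2) JM by blast
  have part: "(\<lambda>v. \<exists>t\<in>M'. A t v) \<in> S.D" if "M' \<subseteq> M" for M'
    unfolding A_def by (rule S.affine_disj_subset[OF fin(1) srt(1) JM sub P that])
  have AS: "A t \<in> S.D" if "t \<in> M" for t
    using part[of "{t}"] that by simp
  have AT: "A t \<in> T.D" if t: "t \<in> M" for t
  proof -
    have "A t v \<longleftrightarrow> (\<Sum>p\<in>insert t (I t). v p) = e t" for v
      using finI[OF t] nI[OF t t] by (simp add: A_def)
    then have eq: "A t = (\<lambda>v. (\<Sum>p\<in>insert t (I t). v p) = e t)" by blast
    show ?thesis unfolding eq
    proof (rule linear_transfer)
      show "(\<lambda>v. (\<Sum>p\<in>insert t (I t). v p) = e t) \<in> S.D" using AS[OF t] unfolding eq .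
    qed (use finI[OF t] t sub[OF t] srt in auto)
  qed
  have A_upd: "A t (v(t := a)) \<longleftrightarrow> a + (\<Sum>p\<in>I t. v p) = e t" if "t \<in> M" for t v a
    using nI[OF that that] finI[OF that] by (simp add: A_def sum_upd fun_upd_same del: fun_upd_apply)
  have k1: "fst t1 \<in> {1..k}" using t1 srt by auto
  have link: "(\<lambda>v. v x = v y \<or> A s v) \<in> T.D"
    if s: "s \<in> M" "s \<noteq> t1" and xy: "fst x = fst t1" "fst y = fst t1" for s x y
  proof (cases "I s = {}")
    case True
    have sk: "fst s \<in> {1..k}" using s srt by auto
    have "(\<lambda>v. v a = v b \<or> v u = e s) \<in> S.D"
      if ab: "fst a = fst t1" "fst b = fst t1" "fst u = fst s" for a b u
    proof -
      obtain t' where t': "fst t' = fst t1" "t' \<notin> insert t1 (insert s J)"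
        using fin by (metis finite_insert fresh_var)
      have ne: "t1 \<noteq> t'" "t' \<noteq> s" "t' \<notin> I t1" using t' sub[OF t1(1)] by auto
      \<comment> \<open>The second conjunct makes \<open>t'\<close> solve the equation for
        \<open>t1\<close>, so this equation becomes \<open>v t1 = v t'\<close> once \<open>J\<close>
        is eliminated.\<close>
      have "(\<lambda>v. (\<exists>t\<in>{t1, s}. A t v) \<and> A t1 (v(t1 := v t'))) \<in> S.D" (is "?Q \<in> _")
        using t1 s t' by (intro S.conj_D part S.subst_D[OF AS]) auto
      then have "(\<lambda>v. \<exists>w. ?Q (override_on v w J)) \<in> S.D"
        by (rule S.ex_set_D) (use fin srt in auto)
      moreover have "(\<exists>w. ?Q (override_on v w J)) \<longleftrightarrow> v t1 = v t' \<or> v s = e s" for v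
      proof -
        have "?Q (override_on v w J) \<longleftrightarrow>
          (v t1 + (\<Sum>p\<in>I t1. w p) = e t1 \<or> v s = e s) \<and> v t' + (\<Sum>p\<in>I t1. w p) = e t1" for w
        proof -
          have "t1 \<notin> J" "s \<notin> J" "t' \<notin> J" using t1 s JM t' by auto
          then show ?thesis unfolding A_upd[OF t1(1)]
            by (simp add: A_def True bit_sum_override(1) sub t1)
        qed
        moreover have "(\<exists>w. R (\<Sum>p\<in>I t1. w p)) \<longleftrightarrow> (\<exists>b. R b)" for R :: "bit \<Rightarrow> bool"
          using solve_one_bit[OF finI[OF t1(1)] t1(2)] by metis
        ultimately have "(\<exists>w. ?Q (override_on v w J)) \<longleftrightarrow>
          (\<exists>b. (v t1 + b = e t1 \<or> v s = e s) \<and> v t' + b = e t1)" by simp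
        also have "\<dots> \<longleftrightarrow> v t1 = v t' \<or> v s = e s"
          unfolding ex_bit by (cases "v t1"; cases "v t'"; cases "e t1") auto
        finally show ?thesis .
      qed
      ultimately have "(\<lambda>v. v t1 = v t' \<or> v s = e s) \<in> S.D" by simp
      then have "(\<lambda>v. (\<lambda>v. v t1 = v t' \<or> v s = e s) (v \<circ> id(t1 := a, t' := b, s := u))) \<in> S.D"
        by (rule S.rename_D) (use ab t' in auto)
      then show ?thesis using ne s(2) by simp
    qed
    then have "(\<lambda>v. v x = v y \<or> v s = e s) \<in> T.D"
      by (rule c2_transfer[OF k1 sk]) (use xy in auto)
    then show ?thesis by (simp add: A_def True)
  next
    case False
    have sk: "fst s \<in> {1..k}" using s srt by auto
    have "(\<lambda>v. v a = v b \<or> v u = v u') \<in> S.D"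
      if "fst a = fst t1" "fst b = fst t1" "fst u = fst s" "fst u' = fst s" for a b u u'
    proof (rule S.eq_disj_from_linear_disj[OF fin(2) sub[OF t1(1)] sub[OF s(1)] t1(2) False])
      show "(\<lambda>v. v t1 + (\<Sum>p\<in>I t1. v p) = e t1 \<or> v s + (\<Sum>p\<in>I s. v p) = e s) \<in> S.D"
        using part[of "{t1, s}"] t1 s by (simp add: A_def)
      show "(\<lambda>v. v t1 + (\<Sum>p\<in>I t1. v p) = e t1) \<in> S.D" "(\<lambda>v. v s + (\<Sum>p\<in>I s. v p) = e s) \<in> S.D"
        using AS[OF t1(1)] AS[OF s(1)] by (simp_all add: A_def[abs_def])
    qed (use that t1 s srt JM k1 sk in auto)
    then have W: "(\<lambda>v. v a = v b \<or> v u = v u') \<in> T.D"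
      if "fst a = fst t1" "fst b = fst t1" "fst u = fst s" "fst u' = fst s" for a b u u'
      by (rule c3_transfer[OF k1 sk]) (use that in auto)
    obtain z where z: "fst z = fst s" "z \<notin> insert x (insert y (insert s J))"
      using fin by (metis finite_insert fresh_var)
    have ne: "x \<noteq> z" "y \<noteq> z" "s \<noteq> z" "z \<notin> I s" using z sub[OF s(1)] by auto
    \<comment> \<open>\<open>z\<close> is forced to solve the equation for \<open>s\<close>, so
      \<open>v s = v z\<close> says that \<open>s\<close> satisfies it.\<close>
    have "(\<lambda>v. (v x = v y \<or> v s = v z) \<and> A s (v(s := v z))) \<in> T.D" (is "?Q \<in> _")
      by (intro T.conj_D W T.subst_D[OF AT]) (use xy s z in auto)
    then have "(\<lambda>v. \<exists>m. ?Q (v(z := m))) \<in> T.D" by (rule T.ex_D) (use z sk in simp)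
    moreover have "(\<exists>m. ?Q (v(z := m))) \<longleftrightarrow> v x = v y \<or> A s v" for v
    proof -
      have Q: "?Q (v(z := m)) \<longleftrightarrow> (v x = v y \<or> v s = m) \<and> m + (\<Sum>p\<in>I s. v p) = e s" for m
        unfolding A_upd[OF s(1)] using ne finI[OF s(1)]
        by (simp add: sum_upd fun_upd_same fun_upd_other del: fun_upd_apply)
      have "(\<exists>m. (R \<or> a = m) \<and> m + b = c) \<longleftrightarrow> R \<or> a + b = c" for R and a b c :: bit
        unfolding ex_bit by (cases a; cases b; cases c) auto
      then show ?thesis unfolding Q unfolding A_def .
    qed
    ultimately show ?thesis by simp
  qed
  have chain: "(\<lambda>v. v x = v y \<or> (\<exists>t\<in>M'. A t v)) \<in> T.D"
    if "M' \<subseteq> M - {t1}" "fst x = fst t1" "fst y = fst t1" for M' x y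
  proof -
    have "finite M'" using that fin finite_subset by blast
    then show ?thesis using that
    proof (induction M' arbitrary: x y rule: finite_induct)
      case empty
      then show ?case using k1 by (auto intro: T.eq_D)
    next
      case (insert s M')
      obtain z where z: "fst z = fst t1" "z \<notin> insert x (insert y (M \<union> J))"
        using fin by (metis finite_Un finite_insert fresh_var)
      have ne: "x \<noteq> z" "y \<noteq> z" using z by auto
      \<comment> \<open>The intermediate \<open>z\<close> is set to \<open>y\<close> if a disjunct
        from \<open>M'\<close> holds and to \<open>x\<close> if the one for \<open>s\<close>
        holds.\<close>
      have "(\<lambda>v. (v x = v z \<or> (\<exists>t\<in>M'. A t v)) \<and> (v z = v y \<or> A s v)) \<in> T.D" (is "?Q \<in> _")
        using insert.prems z by (intro T.conj_D insert.IH link) auto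
      then have "(\<lambda>v. \<exists>m. ?Q (v(z := m))) \<in> T.D" by (rule T.ex_D) (use z k1 in simp)
      moreover have A_z: "A t (v(z := m)) = A t v" if "t \<in> M" for t v m
        using z(2) sub[OF that] finI[OF that] that unfolding A_def
        by (subst sum_upd(2)) auto
      have "(\<exists>m. ?Q (v(z := m))) \<longleftrightarrow> v x = v y \<or> (\<exists>t\<in>insert s M'. A t v)" for v
      proof -
        have "A s (v(z := m)) = A s v" "(\<exists>t\<in>M'. A t (v(z := m))) = (\<exists>t\<in>M'. A t v)" for m
          using insert.prems(1) A_z by blast+
        then show ?thesis using ne by auto
      qed
      ultimately show ?case by simp
    qed
  qed
  obtain z where z: "fst z = fst t1" "z \<notin> M \<union> J"
    using fin by (metis finite_Un fresh_var)
  \<comment> \<open>Here \<open>z\<close> solves the equation for \<open>t1\<close>, so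
    \<open>v t1 = v z\<close> expresses that equation.\<close>
  have "(\<lambda>v. (v t1 = v z \<or> (\<exists>t\<in>M - {t1}. A t v)) \<and> A t1 (v(t1 := v z))) \<in> T.D" (is "?Q \<in> _")
    by (intro T.conj_D chain T.subst_D[OF AT]) (use z t1 in auto)
  then have "(\<lambda>v. \<exists>m. ?Q (v(z := m))) \<in> T.D" by (rule T.ex_D) (use z k1 in simp)
  moreover have "(\<exists>m. ?Q (v(z := m))) \<longleftrightarrow> (\<exists>t\<in>M. A t v)" for v
  proof -
    have A_z: "A t (v(z := m)) = A t v" if "t \<in> M" for t m
      using z(2) sub[OF that] finI[OF that] that unfolding A_def
      by (subst sum_upd(2)) auto
    have "z \<notin> I t1" "t1 \<noteq> z" using z sub[OF t1(1)] t1 by auto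
    then have Q: "?Q (v(z := m)) \<longleftrightarrow> (v t1 = m \<or> (\<exists>t\<in>M - {t1}. A t v)) \<and> m + (\<Sum>p\<in>I t1. v p) = e t1" for m
      unfolding A_upd[OF t1(1)] using finI[OF t1(1)] A_z
      by (simp add: sum_upd fun_upd_same fun_upd_other del: fun_upd_apply)
    have "(\<exists>m. (a = m \<or> R) \<and> m + b = c) \<longleftrightarrow> a + b = c \<or> R" for R and a b c :: bit
      unfolding ex_bit by (cases a; cases b; cases c) auto
    then have "(\<exists>m. ?Q (v(z := m))) \<longleftrightarrow> A t1 v \<or> (\<exists>t\<in>M - {t1}. A t v)"
      unfolding Q unfolding A_def[of t1] .
    then show ?thesis using t1 by blast
  qed
  ultimately show ?thesis by (simp add: A_def)
qed

text \<open>\<open>P\<close> is the conjunction of the separating predicates for the points where it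
  fails; points vanishing outside \<open>X\<close> suffice, and there are finitely many.\<close>

lemma definable_transfer:
  assumes P: "P \<in> S.D"
  shows "P \<in> T.D"
proof -
  obtain X where X: "finite X" "fst ` X \<subseteq> {1..k}" "depends_on X P" using S.support[OF P] .
  define F where "F = {a. \<not> P a \<and> (\<forall>x. x \<notin> X \<longrightarrow> a x = 0)}"
  have finF: "finite F"
    by (rule finite_subset[OF _ finite_valuations[OF X(1)]]) (auto simp: F_def)
  have "\<exists>Q. Q \<in> T.D \<and> depends_on X Q \<and> (\<forall>v. P v \<longrightarrow> Q v) \<and> \<not> Q a" if "a \<in> F" for a
  proof -
    have "\<not> P a" using that by (simp add: F_def)
    from S.separating_predicate[OF X(1,2) P X(3) this] obtain Q
      where Q: "Q \<in> S.D" "depends_on X Q" "\<And>v. P v \<Longrightarrow> Q v" "\<not> Q a"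
        "\<And>c d. \<not> Q c \<Longrightarrow> \<not> Q d \<Longrightarrow> \<not> Q (\<lambda>x. a x + c x + d x)" by blast
    from affine_complement_form[OF X(1) Q(2,4,5)] obtain J M I e
      where JM: "J \<inter> M = {}" "J \<union> M = X" "\<And>t. t \<in> M \<Longrightarrow> I t \<subseteq> J"
        and eq: "Q = (\<lambda>v. \<exists>t\<in>M. v t + (\<Sum>p\<in>I t. v p) = e t)" by blast
    have "Q \<in> T.D" unfolding eq
    proof (rule affine_disj_transfer[where J = J])
      show "(\<lambda>v. \<exists>t\<in>M. v t + (\<Sum>p\<in>I t. v p) = e t) \<in> S.D" using Q(1) unfolding eq .
    qed (use JM X in auto)
    then show ?thesis using Q by blast
  qed
  then obtain Q where Q: "\<And>a. a \<in> F \<Longrightarrow> Q a \<in> T.D" "\<And>a. a \<in> F \<Longrightarrow> depends_on X (Q a)"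
    "\<And>a v. a \<in> F \<Longrightarrow> P v \<Longrightarrow> Q a v" "\<And>a. a \<in> F \<Longrightarrow> \<not> Q a a" by metis
  have "(\<lambda>v. \<forall>a\<in>F. Q a v) \<in> T.D" using finF Q(1) by (rule T.ball_D)
  moreover have "(\<forall>a\<in>F. Q a v) \<longleftrightarrow> P v" for v
  proof
    assume *: "\<forall>a\<in>F. Q a v"
    show "P v"
    proof (rule ccontr)
      assume "\<not> P v"
      let ?a = "override_on (\<lambda>_. 0) v X"
      have "P ?a = P v" by (rule depends_onD[OF X(3)]) simp
      then have a: "?a \<in> F" using \<open>\<not> P v\<close> by (simp add: F_def)
      have "Q ?a v = Q ?a ?a" by (rule depends_onD[OF Q(2)[OF a]]) simp
      then show False using * a Q(4)[OF a] by blast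
    qed
  qed (use Q(3) in blast)
  ultimately show ?thesis by simp
qed

lemma clone_subset: "S \<subseteq> T"
proof
  fix R assume R: "R \<in> S"
  let ?xs = "zip (fst R) [0..<length (fst R)]"
  have srt: "R \<in> sorted_rels k" using R S.sorted by blast
  have xs: "distinct ?xs" "map fst ?xs = fst R" by (simp_all add: distinct_zipI2)
  have "(\<lambda>v. map v ?xs \<in> snd R) \<in> T.D" by (rule definable_transfer[OF S.atom_D[OF R xs(2)]])
  then show "R \<in> T" using T.mem_iff[OF srt xs] by simp
qed

end

section \<open>The embedding\<close>

text \<open>Numbers the pairs of a sort and a bit from 0 to \<open>2 * k - 1\<close>, the
  coordinates of the vectors; 1 is subtracted because sorts start at 1.\<close>

definition literal_index :: "(svar \<Rightarrow> bit) \<Rightarrow> svar \<Rightarrow> nat" where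
  "literal_index e t = 2 * (fst t - 1) + of_bool (e t = 1)"

text \<open>Both bits may occur with the same sort, so these disjunctions are more general than
  those of type (c7).\<close>

definition literal_counts :: "nat \<Rightarrow> srel set \<Rightarrow> (nat \<Rightarrow> nat) set" where
  "literal_counts k S = {n \<in> nat_vecs (2 * k). \<exists>M e. finite M \<and> fst ` M \<subseteq> {1..k} \<and>
     (\<lambda>v. \<exists>t\<in>M. v t = e t) \<in> definable k S \<and> (\<forall>i<2 * k. n i = card {t \<in> M. literal_index e t = i})}"

lemma literal_index_less: "fst t \<in> {1..k} \<Longrightarrow> literal_index e t < 2 * k"
  unfolding literal_index_def by (cases "e t = 1") auto

lemma literal_index_eqD:
  assumes "literal_index e t = literal_index e' t'" "fst t \<ge> 1" "fst t' \<ge> 1"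
  shows "fst t = fst t'" "e t = e' t'"
proof -
  have "e t = 1 \<longleftrightarrow> e' t' = 1"
    using arg_cong[OF assms(1), of odd] by (cases "e t = 1"; cases "e' t' = 1") (auto simp: literal_index_def)
  then show "e t = e' t'" by (cases "e t"; cases "e' t'") auto
  then show "fst t = fst t'" using assms by (simp add: literal_index_def)
qed

lemma literal_counts_mono: "S \<subseteq> T \<Longrightarrow> literal_counts k S \<subseteq> literal_counts k T"
  using definable_mono[of S T k] unfolding literal_counts_def by blast

text \<open>Glues bijections between fibres of equal size; later \<open>h\<close> renames the
  variables of one disjunction of literals into those of another with the same counts.\<close>

lemma fibrewise_surjection:
  assumes "finite A" "finite B" and card: "\<And>i. card {x \<in> A. f x = i} = card {y \<in> B. g y = i}"
  obtains h where "h ` A = B" "\<And>x. x \<in> A \<Longrightarrow> g (h x) = f x"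
proof -
  have "\<exists>b. bij_betw b {x \<in> A. f x = i} {y \<in> B. g y = i}" for i
    using assms by (intro finite_same_card_bij) auto
  then obtain b where b: "\<And>i. bij_betw (b i) {x \<in> A. f x = i} {y \<in> B. g y = i}" by metis
  let ?h = "\<lambda>x. b (f x) x"
  have h: "?h x \<in> B" "g (?h x) = f x" if "x \<in> A" for x
    using bij_betwE[OF b[of "f x"]] that by auto
  moreover have "y \<in> ?h ` A" if "y \<in> B" for y
    using bij_betw_imp_surj_on[OF b[of "g y"]] that by force
  ultimately have "?h ` A = B" by blast
  then show ?thesis using that h(2) by blast
qed

lemma (in clone) literal_counts_downset:
  "literal_counts k S \<in> downsets (nat_vecs (2 * k)) (vec_le (2 * k))"
  unfolding downsets_def
proof (intro CollectI conjI ballI impI)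
  show "literal_counts k S \<subseteq> nat_vecs (2 * k)" by (auto simp: literal_counts_def)
  fix n n' assume n: "n \<in> literal_counts k S" and n': "n' \<in> nat_vecs (2 * k)" and le: "vec_le (2 * k) n' n"
  obtain M e where M: "finite M" "fst ` M \<subseteq> {1..k}" "(\<lambda>v. \<exists>t\<in>M. v t = e t) \<in> D"
    and card: "\<And>i. i < 2 * k \<Longrightarrow> n i = card {t \<in> M. literal_index e t = i}"
    using n unfolding literal_counts_def by blast
  \<comment> \<open>For each coordinate, as many literals are kept as \<open>n'\<close> asks for;
    the others are deleted by universal quantification.\<close>
  have "\<exists>N \<subseteq> {t \<in> M. literal_index e t = i}. card N = n' i" if "i < 2 * k" for i
    using le card[OF that] that unfolding vec_le_def by (metis obtain_subset_with_card_n)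
  then obtain N where N: "\<And>i. i < 2 * k \<Longrightarrow> N i \<subseteq> {t \<in> M. literal_index e t = i}"
    "\<And>i. i < 2 * k \<Longrightarrow> card (N i) = n' i" by metis
  define M' where "M' = (\<Union>i<2 * k. N i)"
  have M': "M' \<subseteq> M" using N(1) by (auto simp: M'_def)
  have "{t \<in> M'. literal_index e t = i} = N i" if "i < 2 * k" for i
    using N(1) that by (auto simp: M'_def)
  then have "\<forall>i<2 * k. n' i = card {t \<in> M'. literal_index e t = i}" using N(2) by simp
  moreover have "(\<lambda>v. \<exists>t\<in>M'. v t = e t) \<in> D"
    using affine_disj_subset[of M "{}" "\<lambda>_. {}" e M'] M M' by simp
  moreover have "finite M'" "fst ` M' \<subseteq> {1..k}" using M M' finite_subset by blast+
  ultimately show "n' \<in> literal_counts k S" using n' unfolding literal_counts_def by blast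
qed

text \<open>The counts determine a disjunction of literals up to renaming variables within sorts, so
  it passes from \<open>S\<close> to \<open>T\<close>. It follows that the assignment even reflects
  inclusion.\<close>

lemma clone_subsetI:
  assumes "clone k S" "clone k T" "S \<inter> CR_1_6 k \<subseteq> T" "literal_counts k S \<subseteq> literal_counts k T"
  shows "S \<subseteq> T"
proof -
  interpret S: clone k S by fact
  interpret T: clone k T by fact
  have "(\<lambda>v. \<exists>t\<in>M. v t = e t) \<in> T.D"
    if M: "finite M" "fst ` M \<subseteq> {1..k}" "(\<lambda>v. \<exists>t\<in>M. v t = e t) \<in> S.D" for M e
  proof -
    \<comment> \<open>Restricted to the coordinates below \<open>2 * k\<close>, since
      \<open>nat_vecs\<close> requires \<open>undefined\<close> elsewhere.\<close>
    define n where "n = (\<lambda>i\<in>{..<2 * k}. card {t \<in> M. literal_index e t = i})"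
    have "n \<in> literal_counts k S"
      unfolding literal_counts_def nat_vecs_def using M by (auto simp: n_def)
    then have "n \<in> literal_counts k T" using assms by blast
    then obtain M' e' where M': "finite M'" "fst ` M' \<subseteq> {1..k}" "(\<lambda>v. \<exists>t\<in>M'. v t = e' t) \<in> T.D"
      and n: "\<And>i. i < 2 * k \<Longrightarrow> n i = card {t \<in> M'. literal_index e' t = i}"
      unfolding literal_counts_def by blast
    have "card {t \<in> M'. literal_index e' t = i} = card {t \<in> M. literal_index e t = i}" for i
    proof (cases "i < 2 * k")
      case True
      then show ?thesis using n[OF True] by (simp add: n_def)
    next
      case False
      have "{t \<in> N. literal_index d t = i} = {}" if "fst ` N \<subseteq> {1..k}" for N d
        using False literal_index_less that by blast
      then show ?thesis using M(2) M'(2) by (simp only:)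
    qed
    then obtain h where h: "h ` M' = M" "\<And>t. t \<in> M' \<Longrightarrow> literal_index e (h t) = literal_index e' t"
      using fibrewise_surjection[OF M'(1) M(1), of "literal_index e'" "literal_index e"] by metis
    have lab: "fst (h t) = fst t" "e (h t) = e' t" if "t \<in> M'" for t
    proof -
      have "fst (h t) \<in> {1..k}" "fst t \<in> {1..k}" using that h(1) M(2) M'(2) by blast+
      then have "fst (h t) \<ge> 1" "fst t \<ge> 1" by auto
      then show "fst (h t) = fst t" "e (h t) = e' t" using literal_index_eqD h(2)[OF that] by blast+
    qed
    have "(\<lambda>v. (\<lambda>v. \<exists>t\<in>M'. v t = e' t) (v \<circ> override_on id h M')) \<in> T.D"
      by (rule T.rename_D[OF M'(3)]) (auto simp: override_on_def lab)
    moreover have "(\<exists>t\<in>M'. (v \<circ> override_on id h M') t = e' t) \<longleftrightarrow> (\<exists>t\<in>M. v t = e t)" for v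
      using lab unfolding h(1)[symmetric] by simp
    ultimately show ?thesis by simp
  qed
  then interpret clone_pair k S T
    using assms by unfold_locales auto
  show ?thesis by (rule clone_subset)
qed

theorem theorem5p7:
  fixes k :: nat
  assumes "k \<ge> 1"
  shows "poset_embeds
           (quantified_relational_clones k) (\<subseteq>)
           (Pow (CR_1_6 k) \<times> downsets (nat_vecs (2 * k)) (vec_le (2 * k)))
           (rel_prod (\<subseteq>) (\<subseteq>))"
  unfolding poset_embeds_def
proof (intro exI conjI)
  let ?\<nu> = "\<lambda>S. (S \<inter> CR_1_6 k, literal_counts k S)"
  have clone: "clone k S" if "S \<in> quantified_relational_clones k" for S
    using assms that by unfold_locales
  show "?\<nu> ` quantified_relational_clones k \<subseteq>
    Pow (CR_1_6 k) \<times> downsets (nat_vecs (2 * k)) (vec_le (2 * k))"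
    using clone.literal_counts_downset[OF clone] by auto
  show "inj_on ?\<nu> (quantified_relational_clones k)"
  proof (rule inj_onI)
    fix S T
    assume *: "S \<in> quantified_relational_clones k" "T \<in> quantified_relational_clones k" "?\<nu> S = ?\<nu> T"
    \<comment> \<open>Equal images satisfy the criterion in both directions, which gives both
      inclusions.\<close>
    then show "S = T"
      using clone_subsetI[OF clone[OF *(1)] clone[OF *(2)]] clone_subsetI[OF clone[OF *(2)] clone[OF *(1)]]
      by auto
  qed
  show "monotone_on (quantified_relational_clones k) (\<subseteq>) (rel_prod (\<subseteq>) (\<subseteq>)) ?\<nu>"
    by (rule monotone_onI) (use literal_counts_mono in auto)
qed

end
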